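(* Let $A\in\mathbb{R}^{m\times n}$, let $I\subseteq\{1,\dots,m\}$ and $J\subseteq\{1,\dots,n\}$ be sets of row and column indices with $|I|=|J|=k\le \operatorname{rank}(A)$, where $k$ is the target rank, let $I_0\subseteq\{1,\dots,m\}$ be a set of extra row indices disjoint from $I$ with $|I_0|$ bounded by a constant times $k$, and put $I_*=I\cup I_0$. Assume that $A(I,J)\in\mathbb{R}^{k\times k}$ is nonsingular, and let $X\in\mathbb{R}^{k\times n}$ be any row space approximator of $A$ such that $X(:,J)\in\mathbb{R}^{k\times k}$ has full row rank. Let $0<\epsilon\ll 1$ be a truncation parameter for the pseudoinverse with $\|A\|_2\gg\epsilon>\gamma\|A\|_2$. Suppose that $A_{I_*J}^{\epsilon}=A(:,J)\,A(I_*,J)_\epsilon^\dagger\,A(I_*,:)$ is computed in floating-point arithmetic with unit roundoff $u$ in the following order: 1. compute $C=A(:,J)$, $U=A(I_*,J)$ and $R=A(I_*,:)$; 2. compute each row of $CU_\epsilon^\dagger$ using a backward stable (rank-deficient) underdetermined linear solver; 3. compute $CU_\epsilon^\dagger$ times $R$. Let $fl(A_{I_*J}^{\epsilon})$ denote the output. Then $$\|A-fl(A_{I_*J}^{\epsilon})\|_F\le 4\sqrt m\,\|Q_C(I_*,:)^\dagger\|_2\,\|Q_X(J,:)^\dagger\|_2\left(\|A(I_n-X^\dagger X)\|_F+2\epsilon\right)+\gamma\,\|A\|_2\,\|Q_C(I_*,:)^\dagger\|_2 ,$$ where $Q_C\in\mathbb{R}^{m\times k}$ and $Q_X\in\mathbb{R}^{n\times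 k}$ are matrices with orthonormal columns spanning the column spaces of $C=A(:,J)$ and $X^T$, respectively, and $I_n$ is the $n\times n$ identity matrix.
   Context: Notation: $A(I,J)$ is the submatrix of $A$ with rows $I$ and columns $J$; $A(:,J)$ and $A(I,:)$ are the submatrices of columns $J$ and rows $I$. $\dagger$ is the Moore–Penrose pseudoinverse; $\|\cdot\|_2$ is the spectral norm (or vector $\ell_2$ norm) and $\|\cdot\|_F$ the Frobenius norm. For a matrix $B$ and $\epsilon>0$, $B_\epsilon$ is the matrix obtained from $B$ by replacing by zero all singular values of $B$ smaller than $\epsilon$ in its SVD, and $B_\epsilon^\dagger=(B_\epsilon)^\dagger$. Floating-point model: $fl(x\ \mathrm{op}\ y)=(x\ \mathrm{op}\ y)(1+\delta)$ with $|\delta|\le u$ for $\mathrm{op}\in\{+,-,*,/\}$, where $u\ll 1$ is the unit roundoff; $fl(\cdot)$ and hats denote computed values. Convention on $\gamma$: $\gamma=p(m,n,k)\,u$, where $p$ is a low-degree polynomial in $m,n,k$; $\gamma$ is used to suppress any constant factors and any terms related to the matrix size and the target rank (but not $\sigma_i(A)$ or $1/\epsilon$), so it may stand for a different such quantity at each occurrence. Details of the computation. Step 1: the computed factors are $\hat C$, $\hat U$, $\hat R$ and satisfy $\hat C=C+E_C$, $\hat U=U+E_U$, $\hat R=R+E_R$ with $\|E_C\|_2,\|E_U\|_2,\|E_R\|_2\le\gamma\|A\|_2$ (these errors are zero if the submatrices are merely extracted). Step 2: for each $i\in\{1,\dots,m\}$, the minimum-norm solution of $\min_x\|(\hat U^T)_\epsilon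 x-[\hat C]_i^T\|_2$ is computed, where $[\hat C]_i$ is the $i$th row of $\hat C$; the computed solution $\hat s_i$, transposed, is the computed $i$th row of $CU_\epsilon^\dagger$. Backward stability of the solver means that the computed minimum-norm solution $\hat s$ of $\min_x\|B_\epsilon x-b\|_2$ satisfies $\hat s=(B_\epsilon+E_1)^\dagger(b+E_2)$ for some $E_1,E_2$ with $\|E_1\|_2\le\gamma\|B_\epsilon\|_2$ and $\|E_2\|_2\le\gamma\|b\|_2$; here this gives $\hat s_i=\left((\hat U^T)_\epsilon+E_i^{(U)}\right)^\dagger\left([\hat C]_i^T+E_i^{(C)}\right)$ with $\|E_i^{(U)}\|_2\le\gamma\|A\|_2$ and $\|E_i^{(C)}\|_2\le\gamma\|A\|_2$, the perturbations depending on $i$. Step 3: the $i$th row of the output is the transpose of the computed matrix-vector product $fl(\hat R^T\hat s_i)$.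
   Formalization: Backward stability of the solver is taken to include that the perturbed matrix B_ε+E_1 has the same rank as B_ε; without this E_1 could create an arbitrarily small nonzero singular value and the bound would fail. The target rank k is taken to be at least 1. *)

theory Defs
  imports
    Complex_Main
    "HOL-Computational_Algebra.Polynomial"
    "Jordan_Normal_Form.DL_Rank"
    "Jordan_Normal_Form.DL_Submatrix"
begin

text \<open>
  Matrices are those of \<open>Jordan_Normal_Form\<close>, whose dimensions are ordinary natural numbers, so
  that one can say that a polynomial is chosen before $m$, $n$ and $k$. Indices start at 0;
  $A(I,J)$ is \<open>submatrix A I J\<close>, and the index set \<open>UNIV\<close> stands for a colon.
\<close>

definition vec_norm2 :: "real vec \<Rightarrow> real" where
  "vec_norm2 v = sqrt (scalar_prod v v)"

definition spec_norm :: "real mat \<Rightarrow> real" where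
  "spec_norm A = (SUP x \<in> {x \<in> carrier_vec (dim_col A). vec_norm2 x \<le> 1}. vec_norm2 (A *\<^sub>v x))"

definition frob_norm :: "real mat \<Rightarrow> real" where
  "frob_norm A = sqrt (\<Sum>i<dim_row A. \<Sum>j<dim_col A. (A $$ (i, j))\<^sup>2)"

abbreviation mat_rank :: "real mat \<Rightarrow> nat" where
  "mat_rank A \<equiv> vec_space.rank (dim_row A) A"

abbreviation column_space :: "real mat \<Rightarrow> real vec set" where
  "column_space A \<equiv> vec_space.col_space (dim_row A) A"

definition orthonormal_columns :: "real mat \<Rightarrow> bool" where
  "orthonormal_columns Q \<longleftrightarrow> transpose_mat Q * Q = 1\<^sub>m (dim_col Q)"

text \<open>The Penrose conditions; they determine \<open>P\<close> uniquely.\<close>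

definition is_pinv :: "real mat \<Rightarrow> real mat \<Rightarrow> bool" where
  "is_pinv A P \<longleftrightarrow>
     P \<in> carrier_mat (dim_col A) (dim_row A) \<and>
     A * P * A = A \<and> P * A * P = P \<and>
     transpose_mat (A * P) = A * P \<and> transpose_mat (P * A) = P * A"

definition pinv :: "real mat \<Rightarrow> real mat" where
  "pinv A = (THE P. is_pinv A P)"

definition is_svd :: "real mat \<Rightarrow> real mat \<Rightarrow> real mat \<Rightarrow> real mat \<Rightarrow> bool" where
  "is_svd B W S V \<longleftrightarrow>
     W \<in> carrier_mat (dim_row B) (dim_row B) \<and> orthonormal_columns W \<and>
     V \<in> carrier_mat (dim_col B) (dim_col B) \<and> orthonormal_columns V \<and>
     S \<in> carrier_mat (dim_row B) (dim_col B) \<and> diagonal_mat S \<and>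
     (\<forall>i < min (dim_row B) (dim_col B). 0 \<le> S $$ (i, i)) \<and>
     B = W * S * transpose_mat V"

text \<open>
  \<open>is_sv_truncation \<epsilon> B Z\<close> says that $Z = B_\epsilon$. The truncated matrix does not depend on the
  choice of the singular value decomposition.
\<close>

definition is_sv_truncation :: "real \<Rightarrow> real mat \<Rightarrow> real mat \<Rightarrow> bool" where
  "is_sv_truncation \<epsilon> B Z \<longleftrightarrow>
     (\<exists>W S V. is_svd B W S V \<and>
        Z = W * map_mat (\<lambda>\<sigma>. if \<sigma> < \<epsilon> then 0 else \<sigma>) S * transpose_mat V)"

text \<open>
  Floating-point model: \<open>fl_round u z z'\<close> says that \<open>z'\<close> may be the computed value of a single
  arithmetic operation whose exact result is \<open>z\<close>. An inner product over a finite nonempty index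
  set may be summed in any order, that is, along any binary tree.
\<close>

definition fl_round :: "real \<Rightarrow> real \<Rightarrow> real \<Rightarrow> bool" where
  "fl_round u z z' \<longleftrightarrow> (\<exists>\<delta>. \<bar>\<delta>\<bar> \<le> u \<and> z' = z * (1 + \<delta>))"

inductive fl_inner :: "real \<Rightarrow> real vec \<Rightarrow> real vec \<Rightarrow> nat set \<Rightarrow> real \<Rightarrow> bool"
  for u :: real and x y :: "real vec" where
  fl_inner_product: "fl_round u (x $ i * y $ i) z \<Longrightarrow> fl_inner u x y {i} z"
| fl_inner_sum:
    "fl_inner u x y S a \<Longrightarrow> fl_inner u x y T b \<Longrightarrow> S \<inter> T = {} \<Longrightarrow> fl_round u (a + b) z
     \<Longrightarrow> fl_inner u x y (S \<union> T) z"

definition fl_mult_mat_vec :: "real \<Rightarrow> real mat \<Rightarrow> real vec \<Rightarrow> real vec \<Rightarrow> bool" where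
  "fl_mult_mat_vec u M x y \<longleftrightarrow>
     y \<in> carrier_vec (dim_row M) \<and>
     (\<forall>j < dim_row M. fl_inner u (row M j) x {..<dim_vec x} (y $ j))"

text \<open>
  \<open>backward_stable_min_norm_solution g \<epsilon> B b s\<close>: the computed minimum-norm solution \<open>s\<close> of
  $\min_x \|B_\epsilon x - b\|_2$ is the exact minimum-norm solution of a nearby problem
  \<open>B\<^sub>\<epsilon> + E1\<close>, \<open>b + E2\<close>, with relative backward error \<open>g\<close>. The nearby problem has the same rank as
  $B_\epsilon$: a solver for rank-deficient problems works with a fixed numerical rank. Without this
  requirement \<open>E1\<close> could turn a zero singular value of $B_\epsilon$ into an arbitrarily small
  nonzero one, and no bound on \<open>s\<close> would follow.
\<close>

definition backward_stable_min_norm_solution ::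
    "real \<Rightarrow> real \<Rightarrow> real mat \<Rightarrow> real vec \<Rightarrow> real vec \<Rightarrow> bool" where
  "backward_stable_min_norm_solution g \<epsilon> B b s \<longleftrightarrow>
     (\<exists>Z E1 E2. is_sv_truncation \<epsilon> B Z \<and>
        E1 \<in> carrier_mat (dim_row B) (dim_col B) \<and> spec_norm E1 \<le> g * spec_norm Z \<and>
        E2 \<in> carrier_vec (dim_row B) \<and> vec_norm2 E2 \<le> g * vec_norm2 b \<and>
        mat_rank (Z + E1) = mat_rank Z \<and>
        s = pinv (Z + E1) *\<^sub>v (b + E2))"

text \<open>
  \<open>computed_with_error e M M'\<close>: \<open>M'\<close> is \<open>M\<close> up to an absolute error of spectral norm at most \<open>e\<close>.
\<close>

definition computed_with_error :: "real \<Rightarrow> real mat \<Rightarrow> real mat \<Rightarrow> bool" where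
  "computed_with_error e M M' \<longleftrightarrow>
     (\<exists>E \<in> carrier_mat (dim_row M) (dim_col M). spec_norm E \<le> e \<and> M' = M + E)"

text \<open>
  \<open>is_fl_cur u g \<epsilon> A Is J F\<close>: \<open>F\<close> is a possible floating-point output when
  $A(:,J)\,A(I_*,J)_\epsilon^\dagger\,A(I_*,:)$ is computed, with \<open>Is\<close> for $I_*$ and \<open>g\<close> for the
  $\gamma$ in the error bounds for the extraction of the factors and for the solver. The rows of
  $CU_\epsilon^\dagger$ are obtained from least-squares problems with the transpose of the computed
  $U$, with errors that may differ from row to row.
\<close>

definition is_fl_cur ::
    "real \<Rightarrow> real \<Rightarrow> real \<Rightarrow> real mat \<Rightarrow> nat set \<Rightarrow> nat set \<Rightarrow> real mat \<Rightarrow> bool" where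
  "is_fl_cur u g \<epsilon> A Is J F \<longleftrightarrow>
     F \<in> carrier_mat (dim_row A) (dim_col A) \<and>
     (\<exists>C' U' R' s.
        computed_with_error (g * spec_norm A) (submatrix A UNIV J) C' \<and>
        computed_with_error (g * spec_norm A) (submatrix A Is J) U' \<and>
        computed_with_error (g * spec_norm A) (submatrix A Is UNIV) R' \<and>
        (\<forall>i < dim_row A.
           backward_stable_min_norm_solution g \<epsilon> (transpose_mat U') (row C' i) (s i) \<and>
           fl_mult_mat_vec u (transpose_mat R') (s i) (row F i)))"

text \<open>
  $\gamma = p(m,n,k)\,u$, where the polynomial $p$ in three variables is an element of
  $\mathbb{R}[z][y][x]$.
\<close>

definition poly3 :: "real poly poly poly \<Rightarrow> real \<Rightarrow> real \<Rightarrow> real \<Rightarrow> real" where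
  "poly3 p x y z = poly (poly (poly p [:[:x:]:]) [:y:]) z"

definition gamma_factor :: "real poly poly poly \<Rightarrow> nat \<Rightarrow> nat \<Rightarrow> nat \<Rightarrow> real \<Rightarrow> real" where
  "gamma_factor p m n k u = poly3 p (real m) (real n) (real k) * u"

end

theory Submission
  imports Defs "HOL-Analysis.L2_Norm" "Jordan_Normal_Form.DL_Rank_Submatrix"
begin

text \<open>
  Interpolation of rows. Let \<open>V = Q\<^sub>X(J,:)\<close> and \<open>L = Q\<^sub>X V\<^sup>-\<^sup>1\<close>. Then \<open>x \<mapsto> L x(J)\<close> is an oblique
  projector onto the row space of \<open>X\<close> of norm at most \<open>\<nu> = \<parallel>V\<^sup>-\<^sup>1\<parallel>\<close>, and so is its complement. Hence
  every combination \<open>A\<^sup>T z\<close> of rows of \<open>A\<close> agrees with \<open>L (A\<^sup>T z)(J)\<close> up to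
  \<open>\<nu> \<parallel>A (I - X\<^sup>\<dagger> X)\<parallel>\<^sub>F \<parallel>z\<parallel>\<close>. This replaces \<open>A\<close> by \<open>C\<close> and \<open>R\<close> by \<open>U\<close>, so that no product
  \<open>\<parallel>(U\<^sub>\<epsilon>)\<^sup>\<dagger>\<parallel> \<parallel>R\<parallel>\<close>, hence no factor \<open>\<parallel>A\<parallel> / \<epsilon>\<close>, occurs.

  Coefficients. The rows of \<open>C\<close> are \<open>c = U\<^sup>T w\<close> with \<open>\<parallel>w\<parallel> \<le> \<beta> = \<parallel>Q\<^sub>C(I\<^sub>*,:)\<^sup>\<dagger>\<parallel>\<close>.

  The solver. Each row is solved with a matrix \<open>G\<close> that differs from \<open>U\<^sup>T\<close> by little more than \<open>\<epsilon>\<close>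
  and has the rank of the truncated matrix, which gives \<open>\<parallel>G\<^sup>\<dagger>\<parallel> \<le> 1 / (\<epsilon> - \<parallel>E\<parallel>)\<close>. Therefore
  \<open>U\<^sup>T G\<^sup>\<dagger>\<close> and \<open>G\<^sup>\<dagger> U\<^sup>T\<close> are bounded by a constant, \<open>U\<^sup>T - U\<^sup>T G\<^sup>\<dagger> U\<^sup>T\<close> is \<open>O(\<epsilon>)\<close>, and the computed
  solution is \<open>O(\<beta>)\<close>. Errors of size \<open>\<gamma> \<parallel>A\<parallel> \<le> \<epsilon> / 100\<close> multiplied by \<open>\<nu>\<close> are absorbed in the
  term \<open>2 \<epsilon>\<close>; those made in the final product contribute \<open>\<gamma> \<parallel>A\<parallel> \<beta>\<close>.
\<close>

section \<open>Vector and matrix norms\<close>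

text \<open>Links the norm to \<open>L2_set\<close>, so that the Cauchy-Schwarz and triangle
  inequalities proved there become available.\<close>

lemma vec_norm2_L2_set: "vec_norm2 v = L2_set (\<lambda>i. v $ i) {0..<dim_vec v}"
  by (simp add: vec_norm2_def scalar_prod_def L2_set_def power2_eq_square)

lemma vec_norm2_nonneg [simp]: "0 \<le> vec_norm2 v"
  by (simp add: vec_norm2_L2_set)

lemma vec_norm2_sq: "(vec_norm2 v)\<^sup>2 = v \<bullet> v"
  unfolding vec_norm2_def by (simp add: scalar_prod_def sum_nonneg)

lemma vec_norm2_zero [simp]: "vec_norm2 (0\<^sub>v n) = 0"
  by (simp add: vec_norm2_L2_set L2_set_def)

lemma vec_norm2_eq_0_iff: "v \<in> carrier_vec n \<Longrightarrow> vec_norm2 v = 0 \<longleftrightarrow> v = 0\<^sub>v n"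
  by (auto simp: vec_norm2_L2_set L2_set_eq_0_iff)

lemma vec_norm2_smult: "vec_norm2 (c \<cdot>\<^sub>v v) = \<bar>c\<bar> * vec_norm2 v"
  by (simp add: vec_norm2_L2_set L2_set_def power_mult_distrib real_sqrt_mult
      flip: sum_distrib_left)

lemma vec_norm2_uminus [simp]: "vec_norm2 (- v) = vec_norm2 v"
  by (simp add: vec_norm2_L2_set L2_set_def)

lemma scalar_prod_le_vec_norm2:
  assumes "v \<in> carrier_vec n" "w \<in> carrier_vec n"
  shows "\<bar>v \<bullet> w\<bar> \<le> vec_norm2 v * vec_norm2 w"
proof -
  have "\<bar>v \<bullet> w\<bar> \<le> (\<Sum>i\<in>{0..<n}. \<bar>v $ i\<bar> * \<bar>w $ i\<bar>)"
    using assms unfolding scalar_prod_def by (auto simp: abs_mult intro: order.trans[OF sum_abs])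
  also have "\<dots> \<le> vec_norm2 v * vec_norm2 w"
    using L2_set_mult_ineq[of "\<lambda>i. v $ i" "\<lambda>i. w $ i" "{0..<n}"] assms
    by (simp add: vec_norm2_L2_set)
  finally show ?thesis .
qed

lemma vec_norm2_triangle:
  assumes "v \<in> carrier_vec n" "w \<in> carrier_vec n"
  shows "vec_norm2 (v + w) \<le> vec_norm2 v + vec_norm2 w"
proof -
  have "vec_norm2 (v + w) = L2_set (\<lambda>i. v $ i + w $ i) {0..<n}"
    using assms by (auto simp: vec_norm2_L2_set intro: L2_set_cong)
  then show ?thesis using assms L2_set_triangle_ineq[of "\<lambda>i. v $ i" "\<lambda>i. w $ i" "{0..<n}"]
    by (simp add: vec_norm2_L2_set)
qed

lemma vec_norm2_triangle_diff:
  assumes "v \<in> carrier_vec n" "w \<in> carrier_vec n"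
  shows "vec_norm2 (v - w) \<le> vec_norm2 v + vec_norm2 w"
  using vec_norm2_triangle[of v n "- w"] assms by (simp add: minus_add_uminus_vec)

lemma vec_norm2_add_le:
  assumes "v \<in> carrier_vec n" "w \<in> carrier_vec n" "vec_norm2 v \<le> a" "vec_norm2 w \<le> b"
  shows "vec_norm2 (v + w) \<le> a + b"
  using vec_norm2_triangle[OF assms(1,2)] assms(3,4) by linarith

lemma vec_norm2_diff_le:
  assumes "v \<in> carrier_vec n" "w \<in> carrier_vec n" "vec_norm2 v \<le> a" "vec_norm2 w \<le> b"
  shows "vec_norm2 (v - w) \<le> a + b"
  using vec_norm2_triangle_diff[OF assms(1,2)] assms(3,4) by linarith

lemma index_le_vec_norm2: "i < dim_vec v \<Longrightarrow> \<bar>v $ i\<bar> \<le> vec_norm2 v"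
  using member_le_L2_set[of "{0..<dim_vec v}" i "\<lambda>i. \<bar>v $ i\<bar>"]
  by (simp add: vec_norm2_L2_set L2_set_def)

lemma vec_norm2_unit_vec [simp]: "i < n \<Longrightarrow> vec_norm2 (unit_vec n i) = 1"
  by (simp add: vec_norm2_def)

lemma vec_norm2_le_sum_abs: "vec_norm2 v \<le> (\<Sum>i<dim_vec v. \<bar>v $ i\<bar>)"
  using L2_set_le_sum_abs[of "\<lambda>i. v $ i" "{0..<dim_vec v}"]
  by (simp add: vec_norm2_L2_set lessThan_atLeast0)

lemma vec_norm2_mono:
  assumes "dim_vec v = dim_vec w" "\<And>i. i < dim_vec w \<Longrightarrow> \<bar>v $ i\<bar> \<le> \<bar>w $ i\<bar>"
  shows "vec_norm2 v \<le> vec_norm2 w"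
proof -
  have "L2_set (\<lambda>i. \<bar>v $ i\<bar>) {0..<dim_vec w} \<le> L2_set (\<lambda>i. \<bar>w $ i\<bar>) {0..<dim_vec w}"
    using assms by (intro L2_set_mono) auto
  then show ?thesis using assms(1) by (simp add: vec_norm2_L2_set L2_set_def)
qed

lemma frob_norm_nonneg [simp]: "0 \<le> frob_norm A"
  by (simp add: frob_norm_def sum_nonneg)

lemma frob_norm_rows: "frob_norm A = sqrt (\<Sum>i<dim_row A. (vec_norm2 (row A i))\<^sup>2)"
  unfolding frob_norm_def vec_norm2_sq by (simp add: scalar_prod_def power2_eq_square lessThan_atLeast0)

lemma frob_norm_transpose: "frob_norm (transpose_mat A) = frob_norm A"
  unfolding frob_norm_def by (simp, subst sum.swap) simp

text \<open>Cauchy-Schwarz in every row. Besides estimating the residual of \<open>A\<close>, this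
  gives the boundedness that makes the supremum in \<open>spec_norm\<close> a meaningful real
  number.\<close>

lemma mult_mat_vec_frob_norm:
  assumes "A \<in> carrier_mat m n" "x \<in> carrier_vec n"
  shows "vec_norm2 (A *\<^sub>v x) \<le> frob_norm A * vec_norm2 x"
proof (rule power2_le_imp_le)
  have "(vec_norm2 (A *\<^sub>v x))\<^sup>2 = (\<Sum>i<m. (row A i \<bullet> x)\<^sup>2)"
    using assms unfolding vec_norm2_sq
    by (simp add: scalar_prod_def[of "A *\<^sub>v x"] power2_eq_square lessThan_atLeast0)
  also have "\<dots> \<le> (\<Sum>i<m. (vec_norm2 (row A i))\<^sup>2 * (vec_norm2 x)\<^sup>2)"
    using assms scalar_prod_le_vec_norm2[of "row A _" n x]
    by (intro sum_mono) (metis abs_le_square_iff abs_of_nonneg carrier_matD(1,2) mult_nonneg_nonneg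
        power_mult_distrib row_carrier vec_norm2_nonneg)
  also have "\<dots> = (frob_norm A * vec_norm2 x)\<^sup>2"
    using assms by (simp add: frob_norm_rows power_mult_distrib sum_nonneg sum_distrib_right)
  finally show "(vec_norm2 (A *\<^sub>v x))\<^sup>2 \<le> (frob_norm A * vec_norm2 x)\<^sup>2" .
qed simp

lemma bdd_above_spec_norm:
  "bdd_above ((\<lambda>x. vec_norm2 (A *\<^sub>v x)) ` {x \<in> carrier_vec (dim_col A). vec_norm2 x \<le> 1})"
proof (rule bdd_aboveI2)
  fix x assume "x \<in> {x \<in> carrier_vec (dim_col A). vec_norm2 x \<le> 1}"
  then show "vec_norm2 (A *\<^sub>v x) \<le> frob_norm A"
    using mult_mat_vec_frob_norm[of A "dim_row A" "dim_col A" x]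
    by (smt (verit, best) carrier_mat_triv frob_norm_nonneg mem_Collect_eq mult_left_le)
qed

lemma spec_norm_ge:
  "x \<in> carrier_vec (dim_col A) \<Longrightarrow> vec_norm2 x \<le> 1 \<Longrightarrow> vec_norm2 (A *\<^sub>v x) \<le> spec_norm A"
  unfolding spec_norm_def by (rule cSUP_upper[OF _ bdd_above_spec_norm]) simp

lemma spec_norm_nonneg [simp]: "0 \<le> spec_norm A"
  using spec_norm_ge[of "0\<^sub>v (dim_col A)" A] by (auto intro: order.trans[OF vec_norm2_nonneg])

lemma mult_mat_vec_spec_norm:
  assumes "A \<in> carrier_mat m n" "x \<in> carrier_vec n"
  shows "vec_norm2 (A *\<^sub>v x) \<le> spec_norm A * vec_norm2 x"
proof (cases "vec_norm2 x = 0")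
  case True
  then have "x = 0\<^sub>v n" using vec_norm2_eq_0_iff[OF assms(2)] by simp
  then have "A *\<^sub>v x = 0\<^sub>v m" using assms(1) by (intro eq_vecI) auto
  then show ?thesis using True by simp
next
  case False
  then have pos: "0 < vec_norm2 x" using vec_norm2_nonneg[of x] by linarith
  have "vec_norm2 (A *\<^sub>v ((1 / vec_norm2 x) \<cdot>\<^sub>v x)) \<le> spec_norm A"
    using assms pos by (intro spec_norm_ge) (auto simp: vec_norm2_smult)
  then show ?thesis using assms pos
    by (simp add: mult_mat_vec[OF assms] vec_norm2_smult field_simps)
qed

lemma spec_norm_le:
  assumes "A \<in> carrier_mat m n" "0 \<le> c"
    and "\<And>x. x \<in> carrier_vec n \<Longrightarrow> vec_norm2 (A *\<^sub>v x) \<le> c * vec_norm2 x"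
  shows "spec_norm A \<le> c"
  unfolding spec_norm_def
proof (rule cSUP_least)
  show "{x \<in> carrier_vec (dim_col A). vec_norm2 x \<le> 1} \<noteq> {}"
    by (auto intro!: exI[of _ "0\<^sub>v (dim_col A)"])
  fix x assume x: "x \<in> {x \<in> carrier_vec (dim_col A). vec_norm2 x \<le> 1}"
  then have "vec_norm2 (A *\<^sub>v x) \<le> c * vec_norm2 x" using assms by auto
  also have "\<dots> \<le> c" using x assms(2) by (auto intro: mult_left_le)
  finally show "vec_norm2 (A *\<^sub>v x) \<le> c" .
qed

text \<open>Cauchy-Schwarz in |A^T y|^2 = y . A (A^T y), then one factor |A^T y| is cancelled. The
  constant \<open>c\<close> is free, so that contractions also pass to the transpose.\<close>

lemma mult_mat_vec_transpose_bound:
  assumes A: "A \<in> carrier_mat m n" and y: "y \<in> carrier_vec m" and c: "0 \<le> c"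
    and bound: "\<And>x. x \<in> carrier_vec n \<Longrightarrow> vec_norm2 (A *\<^sub>v x) \<le> c * vec_norm2 x"
  shows "vec_norm2 (transpose_mat A *\<^sub>v y) \<le> c * vec_norm2 y"
proof -
  let ?z = "transpose_mat A *\<^sub>v y"
  have z: "?z \<in> carrier_vec n" using assms by auto
  have "(vec_norm2 ?z)\<^sup>2 = y \<bullet> (A *\<^sub>v ?z)"
    unfolding vec_norm2_sq by (rule transpose_vec_mult_scalar[OF A z y])
  also have "\<dots> \<le> vec_norm2 y * vec_norm2 (A *\<^sub>v ?z)"
    using scalar_prod_le_vec_norm2[of y m "A *\<^sub>v ?z"] assms z by auto
  also have "\<dots> \<le> vec_norm2 y * (c * vec_norm2 ?z)"
    using bound[OF z] by (intro mult_left_mono) auto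
  finally have "vec_norm2 ?z * vec_norm2 ?z \<le> (c * vec_norm2 y) * vec_norm2 ?z"
    by (simp add: power2_eq_square algebra_simps)
  then show ?thesis
    using vec_norm2_nonneg[of ?z] c by (cases "vec_norm2 ?z = 0") (simp_all add: mult_le_cancel_right)
qed

lemma transpose_mult_mat_vec_spec_norm:
  assumes "A \<in> carrier_mat m n" "y \<in> carrier_vec m"
  shows "vec_norm2 (transpose_mat A *\<^sub>v y) \<le> spec_norm A * vec_norm2 y"
  using mult_mat_vec_transpose_bound[OF assms spec_norm_nonneg mult_mat_vec_spec_norm[OF assms(1)]] .

section \<open>Full rank factorizations\<close>

text \<open>Full column rank expressed through the kernel: in this form it passes to products and to
  right factors without counting dimensions.\<close>

definition inj_mat :: "real mat \<Rightarrow> bool" where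
  "inj_mat A \<longleftrightarrow>
     (\<forall>x \<in> carrier_vec (dim_col A). A *\<^sub>v x = 0\<^sub>v (dim_row A) \<longrightarrow> x = 0\<^sub>v (dim_col A))"

lemma inj_matD:
  assumes "inj_mat A" "A \<in> carrier_mat m n" "x \<in> carrier_vec n" "A *\<^sub>v x = 0\<^sub>v m"
  shows "x = 0\<^sub>v n"
  using assms unfolding inj_mat_def by auto

lemma inj_matI:
  assumes "A \<in> carrier_mat m n" "\<And>x. x \<in> carrier_vec n \<Longrightarrow> A *\<^sub>v x = 0\<^sub>v m \<Longrightarrow> x = 0\<^sub>v n"
  shows "inj_mat A"
  using assms unfolding inj_mat_def by auto

lemma mult_mat_vec_zero [simp]: "A \<in> carrier_mat m n \<Longrightarrow> A *\<^sub>v 0\<^sub>v n = 0\<^sub>v m"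
  by (intro eq_vecI) auto

lemma mult_mat_unit_vec:
  fixes A :: "real mat"
  assumes "A \<in> carrier_mat m n" "j < n"
  shows "A *\<^sub>v unit_vec n j = col A j"
  using assms by (intro eq_vecI) auto

lemma inj_mat_mult_right:
  assumes "inj_mat (A * B)" "A \<in> carrier_mat m r" "B \<in> carrier_mat r n"
  shows "inj_mat B"
proof (rule inj_matI[OF assms(3)])
  fix x assume x: "x \<in> carrier_vec n" "B *\<^sub>v x = 0\<^sub>v r"
  then have "(A * B) *\<^sub>v x = 0\<^sub>v m"
    using assms(2,3) by (simp add: assoc_mult_mat_vec[OF assms(2,3)])
  with inj_matD[OF assms(1) _ x(1), of m] assms(2,3) show "x = 0\<^sub>v n" by simp
qed

lemma inj_mat_mult:
  assumes "inj_mat A" "inj_mat B" "A \<in> carrier_mat m r" "B \<in> carrier_mat r n"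
  shows "inj_mat (A * B)"
proof (rule inj_matI)
  fix x assume x: "x \<in> carrier_vec n" "(A * B) *\<^sub>v x = 0\<^sub>v m"
  then have "A *\<^sub>v (B *\<^sub>v x) = 0\<^sub>v m" using assms(3,4) by simp
  then have "B *\<^sub>v x = 0\<^sub>v r" using inj_matD[OF assms(1,3)] x(1) assms(4) by simp
  then show "x = 0\<^sub>v n" using inj_matD[OF assms(2,4)] x(1) by simp
qed (use assms in simp)

lemma left_inverse_imp_inj_mat:
  assumes "A \<in> carrier_mat m n" "B \<in> carrier_mat n m" "B * A = 1\<^sub>m n"
  shows "inj_mat A"
proof (rule inj_matI[OF assms(1)])
  fix x assume x: "x \<in> carrier_vec n" "A *\<^sub>v x = 0\<^sub>v m"
  have "x = (B * A) *\<^sub>v x" using x assms(3) by simp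
  also have "\<dots> = 0\<^sub>v n" using x assms(1,2) by simp
  finally show "x = 0\<^sub>v n" .
qed

lemma inj_mat_square_inverse:
  assumes "A \<in> carrier_mat n n" "inj_mat A"
  obtains B where "B \<in> carrier_mat n n" "B * A = 1\<^sub>m n" "A * B = 1\<^sub>m n"
proof -
  have "det A \<noteq> 0"
    using det_0_iff_vec_prod_zero_field[OF assms(1)] inj_matD[OF assms(2,1)] by auto
  then obtain B where "B \<in> carrier_mat n n" "B * A = 1\<^sub>m n"
    using det_non_zero_imp_unit[OF assms(1)] unfolding Units_def ring_mat_def by auto
  then show ?thesis using mat_mult_left_right_inverse[of B n A] assms(1) that by auto
qed

lemma full_rank_square_inj_mat:
  assumes "A \<in> carrier_mat n n" "mat_rank A = n"
  shows "inj_mat A"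
proof -
  interpret vec_space "TYPE(real)" n .
  have "det A \<noteq> 0" using assms det_rank_iff[OF assms(1)] by simp
  then show ?thesis
    using det_0_iff_vec_prod_zero_field[OF assms(1)] by (intro inj_matI[OF assms(1)]) blast
qed

text \<open>The systems for the columns of \<open>A\<close> are solved one at a time; the solutions
  are the columns of \<open>L\<close>.\<close>

lemma range_subset_factor:
  fixes A :: "real mat"
  assumes "A \<in> carrier_mat m n" "U \<in> carrier_mat m r"
    and "\<And>j. j < n \<Longrightarrow> \<exists>x \<in> carrier_vec r. U *\<^sub>v x = col A j"
  obtains L where "L \<in> carrier_mat r n" "A = U * L"
proof -
  obtain f where f: "\<And>j. j < n \<Longrightarrow> f j \<in> carrier_vec r \<and> U *\<^sub>v f j = col A j"
    using assms(3) by metis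
  define L where "L = mat_of_cols r (map f [0..<n])"
  have L: "L \<in> carrier_mat r n" unfolding L_def by (auto simp: mat_of_cols_def)
  have "col L j = f j" if "j < n" for j
    using that f[OF that] unfolding L_def by (subst col_mat_of_cols) auto
  then have "col A j = col (U * L) j" if "j < n" for j
    using f[OF that] that unfolding col_mult2[OF assms(2) L that] by simp
  then have "A = U * L" using assms(1,2) L by (intro mat_col_eqI) auto
  with L that show ?thesis by blast
qed

lemma column_space_subset_factor:
  assumes "A \<in> carrier_mat m n" "U \<in> carrier_mat m r" "column_space A \<subseteq> column_space U"
  obtains L where "L \<in> carrier_mat r n" "A = U * L"
proof (rule range_subset_factor[OF assms(1,2)])
  interpret vec_space "TYPE(real)" m .
  fix j assume j: "j < n"
  then have "col A j = A *\<^sub>v unit_vec n j" "col A j \<in> carrier_vec m"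
    using assms(1) by (auto simp: mult_mat_unit_vec[of _ m n])
  then have "col A j \<in> col_space A"
    using assms(1) by (auto simp: col_space_eq[OF assms(1)] intro!: bexI[of _ "unit_vec n j"])
  then show "\<exists>x \<in> carrier_vec r. U *\<^sub>v x = col A j"
    using assms by (auto simp: col_space_eq[OF assms(2)])
qed

text \<open>The columns of \<open>U\<close> form a maximal independent set of columns of
  \<open>A\<close>. So \<open>K\<close> selects columns, \<open>L\<close> expresses all columns in
  this basis, and \<open>U * (L * K) = U\<close> will make \<open>K\<close> a right inverse of
  \<open>L\<close>.\<close>

lemma full_rank_factorization:
  assumes A: "A \<in> carrier_mat m n"
  obtains U L K where "U \<in> carrier_mat m (mat_rank A)" "L \<in> carrier_mat (mat_rank A) n"
    "K \<in> carrier_mat n (mat_rank A)" "A = U * L" "U = A * K" "inj_mat U"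
proof -
  interpret vec_space "TYPE(real)" m .
  let ?P = "\<lambda>T. T \<subseteq> set (cols A) \<and> lin_indpt T"
  have colsA: "set (cols A) \<subseteq> carrier_vec m" using A cols_dim by blast
  obtain S where S: "maximal S ?P" "finite S"
    using maximal_exists_superset[of "set (cols A)" ?P "{}"] finite_lin_indpt2[of "{}"] by auto
  have S_cols: "S \<subseteq> set (cols A)" and indpt: "lin_indpt S" using S(1) unfolding maximal_def by auto
  then have S_carrier: "S \<subseteq> carrier_vec m" using colsA by auto
  have rank: "rank A = card S" using rank_card_indpt[OF A S(1)] .
  obtain us where us: "set us = S" "distinct us" using finite_distinct_list[OF S(2)] by auto
  then have len: "length us = rank A" using rank distinct_card by metis
  define U where "U = mat_of_cols m us"
  have U: "U \<in> carrier_mat m (rank A)" unfolding U_def using len by auto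
  have cols_U: "cols U = us" unfolding U_def using us S_carrier by (intro cols_mat_of_cols) auto
  have inj: "inj_mat U"
    using lin_depI[OF U] indpt us cols_U by (intro inj_matI[OF U]) metis
  \<comment> \<open>A column outside the span could be added to \<open>S\<close>, against
    maximality.\<close>
  have span: "c \<in> col_space U" if c: "c \<in> set (cols A)" for c
  proof (rule ccontr)
    assume "c \<notin> col_space U"
    then have "c \<notin> span S" unfolding col_space_def cols_U us .
    moreover have "c \<in> carrier_vec m" using c colsA by auto
    moreover have "c \<notin> S" using span_mem[OF S_carrier] \<open>c \<notin> span S\<close> by blast
    ultimately have "lin_indpt (S \<union> {c})" "c \<notin> S"
      using lin_dep_iff_in_span[OF S_carrier indpt] by blast+
    moreover have "S \<union> {c} \<subseteq> set (cols A)" using S_cols c by blast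
    ultimately show False using S(1) unfolding maximal_def by blast
  qed
  obtain L where L: "L \<in> carrier_mat (rank A) n" "A = U * L"
  proof (rule range_subset_factor[OF A U])
    fix j assume "j < n"
    then have "col A j \<in> set (cols A)" using A by (auto simp: cols_def)
    from span[OF this] show "\<exists>x \<in> carrier_vec (rank A). U *\<^sub>v x = col A j"
      using U by (auto simp: col_space_eq[OF U])
  qed
  obtain K where K: "K \<in> carrier_mat n (rank A)" "U = A * K"
  proof (rule range_subset_factor[OF U A])
    fix j assume "j < rank A"
    then have "col U j \<in> S" using cols_U us U by (metis carrier_matD(2) cols_length cols_nth nth_mem)
    then obtain i where "i < n" "col A i = col U j" using S_cols A by (auto simp: cols_def)
    then show "\<exists>x \<in> carrier_vec n. A *\<^sub>v x = col U j"
      using A by (intro bexI[of _ "unit_vec n i"]) (auto simp: mult_mat_unit_vec[of _ m n])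
  qed
  have "mat_rank A = rank A" using A by simp
  from that[unfolded this, OF U L(1) K(1) L(2) K(2) inj] show ?thesis .
qed

section \<open>The pseudoinverse and its perturbation\<close>

text \<open>\<open>A * P\<close> and \<open>A * Q\<close> are the same orthogonal projector, onto
  the range of \<open>A\<close>; likewise \<open>P * A = Q * A\<close>. Then P = P A P = Q A P = Q A
  Q = Q.\<close>

lemma is_pinv_unique:
  assumes "is_pinv A P" "is_pinv A Q"
  shows "P = Q"
proof -
  define m n where "m = dim_row A" and "n = dim_col A"
  have A: "A \<in> carrier_mat m n" unfolding m_def n_def by simp
  note P = assms(1)[unfolded is_pinv_def, folded m_def n_def]
  note Q = assms(2)[unfolded is_pinv_def, folded m_def n_def]
  have c: "P \<in> carrier_mat n m" "Q \<in> carrier_mat n m" using P Q by auto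
  have AP: "A * P = A * Q"
  proof -
    have "A * P = transpose_mat (A * Q * A * P)" using P Q by metis
    also have "A * Q * A * P = (A * Q) * (A * P)"
      using A c by (intro assoc_mult_mat[of _ m m _ n _ m]) auto
    also have "transpose_mat \<dots> = (A * P) * (A * Q)"
      using A c P Q by (subst transpose_mult[of _ m m _ m]) auto
    also have "\<dots> = A * P * A * Q"
      using A c by (intro assoc_mult_mat[of _ m m _ n _ m, symmetric]) auto
    also have "\<dots> = A * Q" using P by simp
    finally show ?thesis .
  qed
  have PA: "P * A = Q * A"
  proof -
    have "P * A = transpose_mat (P * (A * Q * A))" using P Q by metis
    also have "P * (A * Q * A) = (P * A) * (Q * A)"
      using A c by (simp add: assoc_mult_mat[of _ n m _ n _ n] assoc_mult_mat[of _ m n _ m _ n])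
    also have "transpose_mat \<dots> = (Q * A) * (P * A)"
      using A c P Q by (subst transpose_mult[of _ n n _ n]) auto
    also have "\<dots> = Q * (A * P * A)"
      using A c by (simp add: assoc_mult_mat[of _ n m _ n _ n] assoc_mult_mat[of _ m n _ m _ n])
    also have "\<dots> = Q * A" using P by simp
    finally show ?thesis .
  qed
  have "P = P * A * P" using P by simp
  also have "\<dots> = Q * (A * P)" using PA A c by simp
  also have "\<dots> = Q * A * Q" using AP A c by simp
  also have "\<dots> = Q" using Q by simp
  finally show ?thesis .
qed

lemma pinv_eqI: "is_pinv A P \<Longrightarrow> pinv A = P"
  unfolding pinv_def by (rule the_equality) (auto dest: is_pinv_unique)

text \<open>Normal equations: the pseudoinverse is the inverse of A^T A times A^T. The matrix A^T A
  is injective because A^T A x = 0 forces |A x|^2 = 0.\<close>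

lemma inj_mat_is_pinv:
  assumes A: "A \<in> carrier_mat m n" and inj: "inj_mat A"
  obtains P where "P \<in> carrier_mat n m" "is_pinv A P" "P * A = 1\<^sub>m n"
proof -
  let ?T = "transpose_mat A"
  have T: "?T \<in> carrier_mat n m" using A by simp
  have TA: "?T * A \<in> carrier_mat n n" using A by simp
  have "inj_mat (?T * A)"
  proof (rule inj_matI[OF TA])
    fix x assume x: "x \<in> carrier_vec n" "(?T * A) *\<^sub>v x = 0\<^sub>v n"
    have Ax: "A *\<^sub>v x \<in> carrier_vec m" using A x by simp
    have "(vec_norm2 (A *\<^sub>v x))\<^sup>2 = (?T *\<^sub>v (A *\<^sub>v x)) \<bullet> x"
      unfolding vec_norm2_sq by (rule transpose_vec_mult_scalar[OF A x(1) Ax, symmetric])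
    also have "?T *\<^sub>v (A *\<^sub>v x) = 0\<^sub>v n" using x A by simp
    finally have "vec_norm2 (A *\<^sub>v x) = 0" using x(1) by simp
    then have "A *\<^sub>v x = 0\<^sub>v m" using vec_norm2_eq_0_iff[OF Ax] by simp
    then show "x = 0\<^sub>v n" using inj_matD[OF inj A x(1)] by simp
  qed
  then obtain B where B: "B \<in> carrier_mat n n" "B * (?T * A) = 1\<^sub>m n" "(?T * A) * B = 1\<^sub>m n"
    using inj_mat_square_inverse[OF TA] by blast
  define P where "P = B * ?T"
  have P: "P \<in> carrier_mat n m" using B A by (simp add: P_def)
  have PA: "P * A = 1\<^sub>m n" unfolding P_def using A B T by (simp add: assoc_mult_mat[of _ n n _ m _ n])
  have symTA: "transpose_mat (?T * A) = ?T * A" using A by (simp add: transpose_mult[of _ n m _ n])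
  \<comment> \<open>The inverse of the symmetric matrix A^T A is symmetric; this is what makes
    \<open>A * P\<close> symmetric.\<close>
  have "transpose_mat B = transpose_mat B * ((?T * A) * B)" using B by simp
  also have "\<dots> = (transpose_mat B * (?T * A)) * B"
    using B(1) TA by (intro assoc_mult_mat[symmetric, of _ n n _ n _ n]) auto
  also have "transpose_mat B * (?T * A) = transpose_mat ((?T * A) * B)"
    using B(1) TA symTA by (simp add: transpose_mult[OF TA B(1)])
  also have "\<dots> = 1\<^sub>m n" using B by simp
  finally have symB: "transpose_mat B = B" using B by simp
  have "transpose_mat (A * P) = transpose_mat P * ?T" by (rule transpose_mult[OF A P])
  also have "transpose_mat P = A * B" unfolding P_def using transpose_mult[OF B(1) T] symB by simp
  also have "A * B * ?T = A * P" unfolding P_def by (rule assoc_mult_mat[OF A B(1) T])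
  finally have symAP: "transpose_mat (A * P) = A * P" .
  have "A * P * A = A" using assoc_mult_mat[OF A P A] PA A by simp
  moreover have "P * A * P = P" using PA P by simp
  ultimately have "is_pinv A P"
    unfolding is_pinv_def using A P symAP PA by simp
  with P PA that show ?thesis by blast
qed

lemma pinv_left_inverse:
  assumes "A \<in> carrier_mat m n" "inj_mat A"
  shows "pinv A * A = 1\<^sub>m n"
  using inj_mat_is_pinv[OF assms] pinv_eqI by metis

text \<open>Existence for arbitrary rank: if A = U L with \<open>U\<close> of full column rank and
  \<open>L\<close> of full row rank, then the pseudoinverse of \<open>L\<close> times that of
  \<open>U\<close> satisfies the Penrose conditions. The one of \<open>L\<close> is obtained by
  transposing the full column rank case.\<close>

lemma is_pinv_pinv: "is_pinv A (pinv A)"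
proof -
  define m n where "m = dim_row A" and "n = dim_col A"
  have A: "A \<in> carrier_mat m n" unfolding m_def n_def by simp
  obtain U L K where U: "U \<in> carrier_mat m (mat_rank A)" and L: "L \<in> carrier_mat (mat_rank A) n"
    and K: "K \<in> carrier_mat n (mat_rank A)" and AUL: "A = U * L" and UAK: "U = A * K" and inj: "inj_mat U"
    using full_rank_factorization[OF A] .
  define r where "r = mat_rank A"
  note U = U[folded r_def] and L = L[folded r_def] and K = K[folded r_def]
  obtain P where P: "P \<in> carrier_mat r m" "is_pinv U P" "P * U = 1\<^sub>m r"
    using inj_mat_is_pinv[OF U inj] .
  have UP: "transpose_mat (U * P) = U * P" using P(2) unfolding is_pinv_def by simp
  \<comment> \<open>Cancelling \<open>U\<close> by its left inverse \<open>P\<close> yields L K = 1,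
    so the transpose of \<open>L\<close> has a left inverse.\<close>
  have "U * (L * K) = U" using assoc_mult_mat[OF U L K] AUL UAK by metis
  then have "P * U = (P * U) * (L * K)"
    using assoc_mult_mat[OF P(1) U, of "L * K" r] L K by simp
  then have LK: "L * K = 1\<^sub>m r" using P L K by simp
  have T: "transpose_mat L \<in> carrier_mat n r" "transpose_mat K \<in> carrier_mat r n" using L K by auto
  have "transpose_mat K * transpose_mat L = 1\<^sub>m r"
    using LK transpose_mult[OF L K] by simp
  then have "inj_mat (transpose_mat L)" using left_inverse_imp_inj_mat[OF T] by simp
  then obtain Q where Q: "Q \<in> carrier_mat r n" "is_pinv (transpose_mat L) Q" "Q * transpose_mat L = 1\<^sub>m r"
    using inj_mat_is_pinv[OF T(1)] by blast
  let ?Q = "transpose_mat Q"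
  have Qc: "?Q \<in> carrier_mat n r" using Q by simp
  have LQ: "L * ?Q = 1\<^sub>m r"
    using transpose_mult[OF Q(1) T(1)] Q(3) by simp
  have QL: "transpose_mat (?Q * L) = ?Q * L"
    using Q(2) transpose_mult[OF T(1) Q(1)] transpose_mult[OF Qc L] unfolding is_pinv_def by simp
  have QP: "?Q * P \<in> carrier_mat n m" using Qc P by simp
  have 1: "A * (?Q * P) = U * P"
  proof -
    have "A * (?Q * P) = U * (L * (?Q * P))" unfolding AUL by (rule assoc_mult_mat[OF U L QP])
    also have "L * (?Q * P) = (L * ?Q) * P" by (rule assoc_mult_mat[OF L Qc P(1), symmetric])
    finally show ?thesis using LQ P by simp
  qed
  have 2: "(?Q * P) * A = ?Q * L"
  proof -
    have "(?Q * P) * A = ?Q * (P * A)" by (rule assoc_mult_mat[OF Qc P(1) A])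
    also have "P * A = (P * U) * L" unfolding AUL by (rule assoc_mult_mat[OF P(1) U L, symmetric])
    finally show ?thesis using P L by simp
  qed
  have "A * (?Q * P) * A = A"
    unfolding 1 using assoc_mult_mat[OF U P(1) A] assoc_mult_mat[OF P(1) U L] AUL P(3) left_mult_one_mat[OF L] by metis
  moreover have "(?Q * P) * A * (?Q * P) = ?Q * P"
    unfolding 2 using assoc_mult_mat[OF Qc L QP] assoc_mult_mat[OF L Qc P(1)] LQ P by simp
  ultimately have "is_pinv A (?Q * P)"
    unfolding is_pinv_def using 1 2 UP QL QP A by simp
  then show ?thesis using pinv_eqI by metis
qed

lemma pinv_carrier:
  "A \<in> carrier_mat m n \<Longrightarrow> pinv A \<in> carrier_mat n m"
  using is_pinv_pinv[of A] unfolding is_pinv_def by auto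

section \<open>Orthogonal projectors formed with the pseudoinverse\<close>

lemma orthogonal_projection_contraction:
  assumes M: "M \<in> carrier_mat n n" and sym: "transpose_mat M = M" and idem: "M * M = M"
    and x: "x \<in> carrier_vec n"
  shows "vec_norm2 (M *\<^sub>v x) \<le> vec_norm2 x"
proof -
  have Mx: "M *\<^sub>v x \<in> carrier_vec n" using M x by simp
  \<comment> \<open>Symmetry and idempotence turn |M x|^2 into (M x) . x, to which Cauchy-Schwarz
    applies.\<close>
  have "(vec_norm2 (M *\<^sub>v x))\<^sup>2 = (transpose_mat M *\<^sub>v (M *\<^sub>v x)) \<bullet> x"
    unfolding vec_norm2_sq by (rule transpose_vec_mult_scalar[OF M x Mx, symmetric])
  also have "transpose_mat M *\<^sub>v (M *\<^sub>v x) = M *\<^sub>v x"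
    unfolding sym using assoc_mult_mat_vec[OF M M x] idem by simp
  also have "(M *\<^sub>v x) \<bullet> x \<le> vec_norm2 (M *\<^sub>v x) * vec_norm2 x"
    using scalar_prod_le_vec_norm2[OF Mx x] by simp
  finally have "vec_norm2 (M *\<^sub>v x) * vec_norm2 (M *\<^sub>v x) \<le> vec_norm2 (M *\<^sub>v x) * vec_norm2 x"
    by (simp add: power2_eq_square)
  then show ?thesis
    using vec_norm2_nonneg[of "M *\<^sub>v x"] vec_norm2_nonneg[of x]
    by (cases "vec_norm2 (M *\<^sub>v x) = 0") (simp_all add: mult_le_cancel_left)
qed

lemma mult_pinv_contraction:
  assumes A: "A \<in> carrier_mat m n" and x: "x \<in> carrier_vec m"
  shows "vec_norm2 (A *\<^sub>v (pinv A *\<^sub>v x)) \<le> vec_norm2 x"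
proof -
  have P: "pinv A \<in> carrier_mat n m" and p: "A * pinv A * A = A" "transpose_mat (A * pinv A) = A * pinv A"
    using is_pinv_pinv[of A] A unfolding is_pinv_def by auto
  have AP: "A * pinv A \<in> carrier_mat m m" using A P by simp
  have "(A * pinv A) * (A * pinv A) = A * pinv A"
    using assoc_mult_mat[OF AP A P] p(1) by simp
  from orthogonal_projection_contraction[OF AP p(2) this x] show ?thesis
    using assoc_mult_mat_vec[OF A P x] by simp
qed

lemma pinv_mult_contraction:
  assumes A: "A \<in> carrier_mat m n" and x: "x \<in> carrier_vec n"
  shows "vec_norm2 (pinv A *\<^sub>v (A *\<^sub>v x)) \<le> vec_norm2 x"
proof -
  have P: "pinv A \<in> carrier_mat n m" and p: "pinv A * A * pinv A = pinv A" "transpose_mat (pinv A * A) = pinv A * A"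
    using is_pinv_pinv[of A] A unfolding is_pinv_def by auto
  have AP: "pinv A * A \<in> carrier_mat n n" using A P by simp
  have "(pinv A * A) * (pinv A * A) = pinv A * A"
    using assoc_mult_mat[OF AP P A] p(1) by simp
  from orthogonal_projection_contraction[OF AP p(2) this x] show ?thesis
    using assoc_mult_mat_vec[OF P A x] by simp
qed

lemma mult_pinv_mult_vec:
  assumes A: "A \<in> carrier_mat m n" and x: "x \<in> carrier_vec n"
  shows "A *\<^sub>v (pinv A *\<^sub>v (A *\<^sub>v x)) = A *\<^sub>v x"
proof -
  have P: "pinv A \<in> carrier_mat n m" and p: "A * pinv A * A = A"
    using is_pinv_pinv[of A] A unfolding is_pinv_def by auto
  have "A *\<^sub>v (pinv A *\<^sub>v (A *\<^sub>v x)) = (A * pinv A * A) *\<^sub>v x"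
    using A P x by (simp add: assoc_mult_mat_vec[of _ m m _ n] del: assoc_mult_mat)
  then show ?thesis using p by simp
qed

lemma pinv_mult_pinv_vec:
  assumes A: "A \<in> carrier_mat m n" and x: "x \<in> carrier_vec m"
  shows "pinv A *\<^sub>v (A *\<^sub>v (pinv A *\<^sub>v x)) = pinv A *\<^sub>v x"
proof -
  have P: "pinv A \<in> carrier_mat n m" and p: "pinv A * A * pinv A = pinv A"
    using is_pinv_pinv[of A] A unfolding is_pinv_def by auto
  have "pinv A *\<^sub>v (A *\<^sub>v (pinv A *\<^sub>v x)) = (pinv A * A * pinv A) *\<^sub>v x"
    using A P x by (simp add: assoc_mult_mat_vec[of _ n n _ m] del: assoc_mult_mat)
  then show ?thesis using p by simp
qed

text \<open>By \<open>inj\<close>, the image under \<open>G\<close> of the range of Y Z has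
  dimension rank Z. As this is also the rank of \<open>G\<close>, the image is the whole range of
  \<open>G\<close>.\<close>

lemma same_rank_range:
  assumes G: "G \<in> carrier_mat m n" and Z: "Z \<in> carrier_mat m n" and Y: "Y \<in> carrier_mat n m"
    and rank: "mat_rank G = mat_rank Z"
    and inj: "\<And>x. x \<in> carrier_vec n \<Longrightarrow> G *\<^sub>v (Y *\<^sub>v (Z *\<^sub>v x)) = 0\<^sub>v m \<Longrightarrow> Z *\<^sub>v x = 0\<^sub>v m"
    and v: "v \<in> carrier_vec n"
  obtains x where "x \<in> carrier_vec n" "G *\<^sub>v v = G *\<^sub>v (Y *\<^sub>v (Z *\<^sub>v x))"
proof -
  define r where "r = mat_rank Z"
  obtain U L K where U: "U \<in> carrier_mat m r" and L: "L \<in> carrier_mat r n"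
    and GUL: "G = U * L" and injU: "inj_mat U"
    using full_rank_factorization[OF G] unfolding rank r_def .
  obtain U' L' K' where U': "U' \<in> carrier_mat m r" and K': "K' \<in> carrier_mat n r"
    and UK: "U' = Z * K'" and injU': "inj_mat U'"
    using full_rank_factorization[OF Z] unfolding r_def .
  \<comment> \<open>\<open>M\<close> describes G Y on the range of \<open>Z\<close>, in the bases
    \<open>U'\<close> and \<open>U\<close>. It is square because the ranks agree, so injectivity
    already makes it invertible.\<close>
  define M where "M = L * (Y * U')"
  have M: "M \<in> carrier_mat r r" using L Y U' by (simp add: M_def)
  have G_eq: "G *\<^sub>v (Y *\<^sub>v (Z *\<^sub>v (K' *\<^sub>v w))) = U *\<^sub>v (M *\<^sub>v w)" if w: "w \<in> carrier_vec r" for w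
  proof -
    have "Z *\<^sub>v (K' *\<^sub>v w) = U' *\<^sub>v w" using Z K' w by (simp add: UK)
    moreover have "G *\<^sub>v (Y *\<^sub>v (U' *\<^sub>v w)) = U *\<^sub>v (M *\<^sub>v w)"
      using U L Y U' w by (simp add: GUL M_def assoc_mult_mat_vec[of _ m r _ n]
          assoc_mult_mat_vec[of _ r n _ r] assoc_mult_mat_vec[of _ n m _ r])
    ultimately show ?thesis by simp
  qed
  have "inj_mat M"
  proof (rule inj_matI[OF M])
    fix w assume w: "w \<in> carrier_vec r" "M *\<^sub>v w = 0\<^sub>v r"
    have "G *\<^sub>v (Y *\<^sub>v (Z *\<^sub>v (K' *\<^sub>v w))) = 0\<^sub>v m" using G_eq[OF w(1)] w(2) U by simp
    then have "Z *\<^sub>v (K' *\<^sub>v w) = 0\<^sub>v m" using inj K' w(1) by simp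
    then have "U' *\<^sub>v w = 0\<^sub>v m" using Z K' w by (simp add: UK)
    then show "w = 0\<^sub>v r" using inj_matD[OF injU' U' w(1)] by simp
  qed
  then obtain B where B: "B \<in> carrier_mat r r" "M * B = 1\<^sub>m r" using inj_mat_square_inverse[OF M] by blast
  define w where "w = B *\<^sub>v (L *\<^sub>v v)"
  have w: "w \<in> carrier_vec r" using B L v by (simp add: w_def)
  have "M *\<^sub>v w = L *\<^sub>v v"
    using assoc_mult_mat_vec[OF M B(1), of "L *\<^sub>v v"] B(2) L v by (simp add: w_def)
  then have "G *\<^sub>v v = G *\<^sub>v (Y *\<^sub>v (Z *\<^sub>v (K' *\<^sub>v w)))"
    using G_eq[OF w] U L v by (simp add: GUL)
  then show ?thesis using that[of "K' *\<^sub>v w"] K' w by simp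
qed

text \<open>
  Equality of ranks makes every element of the range of \<open>G = Z + E\<close> an image \<open>G x'\<close> with \<open>x'\<close> in
  the range of \<open>Y Z\<close>, where \<open>Z\<close> is bounded below; the pseudoinverse picks a preimage that is no
  longer than \<open>x'\<close>.
\<close>

lemma pinv_perturbation_bound:
  assumes Z: "Z \<in> carrier_mat m n" and E: "E \<in> carrier_mat m n" and Y: "Y \<in> carrier_mat n m"
    and ZYZ: "\<And>x. x \<in> carrier_vec n \<Longrightarrow> Z *\<^sub>v (Y *\<^sub>v (Z *\<^sub>v x)) = Z *\<^sub>v x"
    and Yb: "\<And>y. y \<in> carrier_vec m \<Longrightarrow> \<epsilon> * vec_norm2 (Y *\<^sub>v y) \<le> vec_norm2 y"
    and Eb: "\<And>x. x \<in> carrier_vec n \<Longrightarrow> vec_norm2 (E *\<^sub>v x) \<le> e * vec_norm2 x"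
    and e: "e < \<epsilon>" and rank: "mat_rank (Z + E) = mat_rank Z" and b: "b \<in> carrier_vec m"
  shows "vec_norm2 (pinv (Z + E) *\<^sub>v b) \<le> vec_norm2 b / (\<epsilon> - e)"
proof -
  let ?G = "Z + E"
  have G: "?G \<in> carrier_mat m n" using Z E by simp
  have P: "pinv ?G \<in> carrier_mat n m" using pinv_carrier[OF G] .
  \<comment> \<open>\<open>Yb\<close> at y = Z x bounds \<open>Z\<close> from below on the range of
    Y Z; passing from \<open>Z\<close> to \<open>?G\<close> costs at most \<open>e\<close>.\<close>
  have below: "(\<epsilon> - e) * vec_norm2 (Y *\<^sub>v (Z *\<^sub>v x)) \<le> vec_norm2 (?G *\<^sub>v (Y *\<^sub>v (Z *\<^sub>v x)))"
    and Z_eq: "Z *\<^sub>v (Y *\<^sub>v (Z *\<^sub>v x)) = Z *\<^sub>v x" if x: "x \<in> carrier_vec n" for x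
  proof -
    let ?x = "Y *\<^sub>v (Z *\<^sub>v x)"
    have x': "?x \<in> carrier_vec n" using Y Z x by simp
    show Zx: "Z *\<^sub>v ?x = Z *\<^sub>v x" using ZYZ[OF x] .
    have "\<epsilon> * vec_norm2 ?x \<le> vec_norm2 (Z *\<^sub>v ?x)" using Yb[of "Z *\<^sub>v x"] Zx Z x by simp
    also have "Z *\<^sub>v ?x = ?G *\<^sub>v ?x - E *\<^sub>v ?x"
      using Z E x' by (auto simp: add_mult_distrib_mat_vec[of _ m n])
    also have "vec_norm2 \<dots> \<le> vec_norm2 (?G *\<^sub>v ?x) + vec_norm2 (E *\<^sub>v ?x)"
      by (rule vec_norm2_triangle_diff[OF mult_mat_vec_carrier[OF G x'] mult_mat_vec_carrier[OF E x']])
    also have "\<dots> \<le> vec_norm2 (?G *\<^sub>v ?x) + e * vec_norm2 ?x" using Eb[OF x'] by simp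
    finally show "(\<epsilon> - e) * vec_norm2 ?x \<le> vec_norm2 (?G *\<^sub>v ?x)" by (simp add: algebra_simps)
  qed
  let ?v = "pinv ?G *\<^sub>v b"
  have v: "?v \<in> carrier_vec n" using P b by simp
  obtain x where x: "x \<in> carrier_vec n" and Gv: "?G *\<^sub>v ?v = ?G *\<^sub>v (Y *\<^sub>v (Z *\<^sub>v x))"
  proof (rule same_rank_range[OF G Z Y rank _ v])
    fix x assume x: "x \<in> carrier_vec n" "?G *\<^sub>v (Y *\<^sub>v (Z *\<^sub>v x)) = 0\<^sub>v m"
    then have "(\<epsilon> - e) * vec_norm2 (Y *\<^sub>v (Z *\<^sub>v x)) \<le> 0" using below[OF x(1)] by simp
    then have "vec_norm2 (Y *\<^sub>v (Z *\<^sub>v x)) = 0"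
      using e vec_norm2_nonneg[of "Y *\<^sub>v (Z *\<^sub>v x)"] by (simp add: mult_le_0_iff)
    then have "Y *\<^sub>v (Z *\<^sub>v x) = 0\<^sub>v n" using vec_norm2_eq_0_iff[of _ n] Y Z x by simp
    then have "Z *\<^sub>v (Y *\<^sub>v (Z *\<^sub>v x)) = 0\<^sub>v m" using Z by simp
    then show "Z *\<^sub>v x = 0\<^sub>v m" using Z_eq[OF x(1)] by simp
  qed
  let ?x = "Y *\<^sub>v (Z *\<^sub>v x)"
  have x': "?x \<in> carrier_vec n" using Y Z x by simp
  have "?v = pinv ?G *\<^sub>v (?G *\<^sub>v ?x)" using pinv_mult_pinv_vec[OF G b] Gv by simp
  then have "vec_norm2 ?v \<le> vec_norm2 ?x" using pinv_mult_contraction[OF G x'] by simp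
  moreover have "(\<epsilon> - e) * vec_norm2 ?x \<le> vec_norm2 b"
    using below[OF x] mult_pinv_contraction[OF G b] Gv by simp
  ultimately show ?thesis using e
    by (smt (verit, best) mult.commute mult_left_mono pos_le_divide_eq)
qed

section \<open>Truncated singular values and rounding errors\<close>

lemma orthonormal_columns_norm:
  assumes "Q \<in> carrier_mat m n" "orthonormal_columns Q" "x \<in> carrier_vec n"
  shows "vec_norm2 (Q *\<^sub>v x) = vec_norm2 x"
proof -
  have Qx: "Q *\<^sub>v x \<in> carrier_vec m" using assms by simp
  have "(vec_norm2 (Q *\<^sub>v x))\<^sup>2 = (transpose_mat Q *\<^sub>v (Q *\<^sub>v x)) \<bullet> x"
    unfolding vec_norm2_sq by (rule transpose_vec_mult_scalar[OF assms(1,3) Qx, symmetric])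
  also have "transpose_mat Q *\<^sub>v (Q *\<^sub>v x) = (transpose_mat Q * Q) *\<^sub>v x"
    using assms by simp
  also have "\<dots> = x" using assms by (simp add: orthonormal_columns_def)
  finally show ?thesis by (simp flip: vec_norm2_sq)
qed

lemma orthonormal_columns_transpose_contraction:
  assumes "Q \<in> carrier_mat m n" "orthonormal_columns Q" "y \<in> carrier_vec m"
  shows "vec_norm2 (transpose_mat Q *\<^sub>v y) \<le> vec_norm2 y"
  using mult_mat_vec_transpose_bound[OF assms(1,3), of 1] orthonormal_columns_norm[OF assms(1,2)]
  by simp

lemma diagonal_mult_mat_vec_index:
  fixes D :: "real mat"
  assumes D: "D \<in> carrier_mat m n" "diagonal_mat D" and x: "x \<in> carrier_vec n" and i: "i < m"
  shows "(D *\<^sub>v x) $ i = (if i < n then D $$ (i, i) * x $ i else 0)"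
proof -
  have "(D *\<^sub>v x) $ i = (\<Sum>j\<in>{0..<n}. D $$ (i, j) * x $ j)"
    using D x i by (simp add: scalar_prod_def)
  also have "\<dots> = (\<Sum>j\<in>{0..<n}. if j = i then D $$ (i, i) * x $ i else 0)"
    using D i unfolding diagonal_mat_def by (intro sum.cong) auto
  also have "\<dots> = (if i < n then D $$ (i, i) * x $ i else 0)"
    by simp
  finally show ?thesis .
qed

lemma diagonal_mult_mat_vec_bound:
  assumes D: "D \<in> carrier_mat m n" "diagonal_mat D" and x: "x \<in> carrier_vec n" and c: "0 \<le> c"
    and bound: "\<And>i. i < m \<Longrightarrow> i < n \<Longrightarrow> \<bar>D $$ (i, i)\<bar> \<le> c"
  shows "vec_norm2 (D *\<^sub>v x) \<le> c * vec_norm2 x"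
proof (rule power2_le_imp_le)
  have "(vec_norm2 (D *\<^sub>v x))\<^sup>2 = (\<Sum>i\<in>{0..<m}. ((D *\<^sub>v x) $ i)\<^sup>2)"
    using D unfolding vec_norm2_sq by (simp add: scalar_prod_def[of "D *\<^sub>v x"] power2_eq_square)
  also have "\<dots> = (\<Sum>i\<in>{0..<m} \<inter> {0..<n}. ((D *\<^sub>v x) $ i)\<^sup>2)"
    using diagonal_mult_mat_vec_index[OF D x] by (intro sum.mono_neutral_right) auto
  also have "\<dots> \<le> (\<Sum>i\<in>{0..<m} \<inter> {0..<n}. c\<^sup>2 * (x $ i)\<^sup>2)"
  proof (intro sum_mono)
    fix i assume i: "i \<in> {0..<m} \<inter> {0..<n}"
    then have "((D *\<^sub>v x) $ i)\<^sup>2 = \<bar>D $$ (i, i)\<bar>\<^sup>2 * (x $ i)\<^sup>2"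
      using diagonal_mult_mat_vec_index[OF D x] by (simp add: power_mult_distrib)
    also have "\<dots> \<le> c\<^sup>2 * (x $ i)\<^sup>2"
      using bound[of i] i by (intro mult_right_mono power_mono) auto
    finally show "((D *\<^sub>v x) $ i)\<^sup>2 \<le> c\<^sup>2 * (x $ i)\<^sup>2" .
  qed
  also have "\<dots> \<le> (\<Sum>i\<in>{0..<n}. c\<^sup>2 * (x $ i)\<^sup>2)"
    by (intro sum_mono2) auto
  also have "\<dots> = (c * vec_norm2 x)\<^sup>2"
    using x unfolding power_mult_distrib vec_norm2_sq
    by (simp add: scalar_prod_def power2_eq_square flip: sum_distrib_left)
  finally show "(vec_norm2 (D *\<^sub>v x))\<^sup>2 \<le> (c * vec_norm2 x)\<^sup>2" .
qed (use c in simp)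

text \<open>\<open>Y\<close> is V R W^T, where \<open>R\<close> inverts the kept singular values, so
  it acts as the pseudoinverse of \<open>Z\<close>. Kept values are at least \<epsilon>, which
  bounds \<open>Y\<close>; removed ones lie between 0 and \<epsilon>, which bounds B - Z.\<close>

lemma sv_truncation_properties:
  assumes B: "B \<in> carrier_mat m n" and trunc: "is_sv_truncation \<epsilon> B Z" and eps: "0 < \<epsilon>"
  obtains Y where "Z \<in> carrier_mat m n" "Y \<in> carrier_mat n m"
    "\<And>x. x \<in> carrier_vec n \<Longrightarrow> Z *\<^sub>v (Y *\<^sub>v (Z *\<^sub>v x)) = Z *\<^sub>v x"
    "\<And>y. y \<in> carrier_vec m \<Longrightarrow> \<epsilon> * vec_norm2 (Y *\<^sub>v y) \<le> vec_norm2 y"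
    "\<And>x. x \<in> carrier_vec n \<Longrightarrow> vec_norm2 (B *\<^sub>v x - Z *\<^sub>v x) \<le> \<epsilon> * vec_norm2 x"
proof -
  let ?f = "\<lambda>\<sigma>. if \<sigma> < \<epsilon> then 0 else \<sigma>"
  obtain W S V where svd: "is_svd B W S V" and Z_eq: "Z = W * map_mat ?f S * transpose_mat V"
    using trunc unfolding is_sv_truncation_def by blast
  have W: "W \<in> carrier_mat m m" "orthonormal_columns W" and V: "V \<in> carrier_mat n n" "orthonormal_columns V"
    and S: "S \<in> carrier_mat m n" "diagonal_mat S" and S_nonneg: "\<And>i. i < m \<Longrightarrow> i < n \<Longrightarrow> 0 \<le> S $$ (i, i)"
    and B_eq: "B = W * S * transpose_mat V"
    using svd B unfolding is_svd_def by auto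
  define T where "T = map_mat ?f S"
  \<comment> \<open>Since \<open>inverse 0 = 0\<close>, the matrix \<open>R\<close> vanishes exactly
    where the truncated diagonal does, and T R T = T holds without a case distinction in the
    definition.\<close>
  define R where "R = mat n m (\<lambda>(i, j). if i = j then inverse (T $$ (i, i)) else 0)"
  define Y where "Y = V * R * transpose_mat W"
  have T: "T \<in> carrier_mat m n" "diagonal_mat T"
    using S eps unfolding T_def diagonal_mat_def by auto
  have R: "R \<in> carrier_mat n m" "diagonal_mat R" unfolding R_def diagonal_mat_def by auto
  have WT: "transpose_mat W \<in> carrier_mat m m" and VT: "transpose_mat V \<in> carrier_mat n n"
    using W V by auto
  have Z: "Z \<in> carrier_mat m n" using Z_eq W V S by simp
  have Y: "Y \<in> carrier_mat n m" unfolding Y_def using W V R by simp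
  have apply3: "(P * D * Q) *\<^sub>v x = P *\<^sub>v (D *\<^sub>v (Q *\<^sub>v x))"
    if "P \<in> carrier_mat a b" "D \<in> carrier_mat b c" "Q \<in> carrier_mat c d" "x \<in> carrier_vec d"
    for P D Q :: "real mat" and a b c d x
    using that by (simp add: assoc_mult_mat_vec[of _ a c _ d] assoc_mult_mat_vec[of _ a b _ c] del: assoc_mult_mat)
  have Bx: "B *\<^sub>v x = W *\<^sub>v (S *\<^sub>v (transpose_mat V *\<^sub>v x))"
    and Zx: "Z *\<^sub>v x = W *\<^sub>v (T *\<^sub>v (transpose_mat V *\<^sub>v x))" if "x \<in> carrier_vec n" for x
    using apply3[OF W(1) S(1) VT that] apply3[OF W(1) T(1) VT that] B_eq Z_eq T_def by auto
  have Yy: "Y *\<^sub>v y = V *\<^sub>v (R *\<^sub>v (transpose_mat W *\<^sub>v y))" if "y \<in> carrier_vec m" for y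
    using apply3[OF V(1) R(1) WT that] Y_def by simp
  have WTW: "transpose_mat W *\<^sub>v (W *\<^sub>v x) = x" if "x \<in> carrier_vec m" for x
    using W that assoc_mult_mat_vec[OF WT W(1) that] by (simp add: orthonormal_columns_def)
  have VTV: "transpose_mat V *\<^sub>v (V *\<^sub>v x) = x" if "x \<in> carrier_vec n" for x
    using V that assoc_mult_mat_vec[OF VT V(1) that] by (simp add: orthonormal_columns_def)
  have TRT: "T *\<^sub>v (R *\<^sub>v (T *\<^sub>v x)) = T *\<^sub>v x" if x: "x \<in> carrier_vec n" for x
  proof (intro eq_vecI)
    fix i assume "i < dim_vec (T *\<^sub>v x)"
    then have i: "i < m" using T by simp
    have Tx: "T *\<^sub>v x \<in> carrier_vec m" and RTx: "R *\<^sub>v (T *\<^sub>v x) \<in> carrier_vec n" using T R x by auto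
    show "(T *\<^sub>v (R *\<^sub>v (T *\<^sub>v x))) $ i = (T *\<^sub>v x) $ i"
      using i by (simp add: diagonal_mult_mat_vec_index[OF T RTx] diagonal_mult_mat_vec_index[OF R Tx]
          diagonal_mult_mat_vec_index[OF T x]) (auto simp: R_def)
  qed (use T in simp)
  have 1: "Z *\<^sub>v (Y *\<^sub>v (Z *\<^sub>v x)) = Z *\<^sub>v x" if x: "x \<in> carrier_vec n" for x
  proof -
    have c: "transpose_mat V *\<^sub>v x \<in> carrier_vec n" "T *\<^sub>v (transpose_mat V *\<^sub>v x) \<in> carrier_vec m"
      "R *\<^sub>v (T *\<^sub>v (transpose_mat V *\<^sub>v x)) \<in> carrier_vec n" using VT T R x by auto
    have "Y *\<^sub>v (Z *\<^sub>v x) = V *\<^sub>v (R *\<^sub>v (T *\<^sub>v (transpose_mat V *\<^sub>v x)))"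
      using Yy[of "Z *\<^sub>v x"] Zx[OF x] WTW[OF c(2)] mult_mat_vec_carrier[OF Z x] by simp
    moreover have "\<dots> \<in> carrier_vec n" using V c by simp
    ultimately show ?thesis using Zx[of "Y *\<^sub>v (Z *\<^sub>v x)"] Zx[OF x] VTV[OF c(3)] TRT[OF c(1)] by simp
  qed
  have 2: "\<epsilon> * vec_norm2 (Y *\<^sub>v y) \<le> vec_norm2 y" if y: "y \<in> carrier_vec m" for y
  proof -
    have c: "transpose_mat W *\<^sub>v y \<in> carrier_vec m" "R *\<^sub>v (transpose_mat W *\<^sub>v y) \<in> carrier_vec n"
      using WT R y by auto
    have "vec_norm2 (Y *\<^sub>v y) = vec_norm2 (R *\<^sub>v (transpose_mat W *\<^sub>v y))"
      using Yy[OF y] orthonormal_columns_norm[OF V c(2)] by simp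
    also have "\<dots> \<le> (1 / \<epsilon>) * vec_norm2 (transpose_mat W *\<^sub>v y)"
      using eps S by (intro diagonal_mult_mat_vec_bound[OF R c(1)])
        (auto simp: R_def T_def field_simps abs_if)
    also have "\<dots> \<le> (1 / \<epsilon>) * vec_norm2 y"
      using orthonormal_columns_transpose_contraction[OF W y] eps by (intro mult_left_mono) auto
    finally show ?thesis using eps by (simp add: field_simps)
  qed
  have 3: "vec_norm2 (B *\<^sub>v x - Z *\<^sub>v x) \<le> \<epsilon> * vec_norm2 x" if x: "x \<in> carrier_vec n" for x
  proof -
    let ?x = "transpose_mat V *\<^sub>v x"
    have c: "?x \<in> carrier_vec n" "S *\<^sub>v ?x \<in> carrier_vec m" "T *\<^sub>v ?x \<in> carrier_vec m" using VT S T x by auto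
    have ST: "S - T \<in> carrier_mat m n" "diagonal_mat (S - T)"
      using S T unfolding diagonal_mat_def by auto
    have "B *\<^sub>v x - Z *\<^sub>v x = W *\<^sub>v (S *\<^sub>v ?x - T *\<^sub>v ?x)"
      using Bx[OF x] Zx[OF x] mult_minus_distrib_mat_vec[OF W(1) c(2,3)] by simp
    also have "S *\<^sub>v ?x - T *\<^sub>v ?x = (S - T) *\<^sub>v ?x"
      using minus_mult_distrib_mat_vec[OF S(1) T(1) c(1)] by simp
    finally have "vec_norm2 (B *\<^sub>v x - Z *\<^sub>v x) = vec_norm2 ((S - T) *\<^sub>v ?x)"
      using orthonormal_columns_norm[OF W] ST c by simp
    also have "\<dots> \<le> \<epsilon> * vec_norm2 ?x"
      using eps S S_nonneg by (intro diagonal_mult_mat_vec_bound[OF ST c(1)]) (auto simp: T_def)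
    also have "\<dots> \<le> \<epsilon> * vec_norm2 x"
      using orthonormal_columns_transpose_contraction[OF V x] eps by (intro mult_left_mono) auto
    finally show ?thesis .
  qed
  show ?thesis by (rule that[OF Z Y 1 2 3])
qed

text \<open>Whatever the summation tree, every term passes through at most \<open>card S\<close>
  roundings: one for the product and at most \<open>card S - 1\<close> for the sums above
  it.\<close>

lemma fl_inner_error:
  assumes "fl_inner u x y S z" "0 \<le> u"
  shows "finite S \<and> S \<noteq> {} \<and>
    \<bar>z - (\<Sum>i\<in>S. x $ i * y $ i)\<bar> \<le> ((1 + u) ^ card S - 1) * (\<Sum>i\<in>S. \<bar>x $ i * y $ i\<bar>)"
  using assms(1)
proof induction
  case (fl_inner_product i z)
  then obtain d where d: "\<bar>d\<bar> \<le> u" "z = x $ i * y $ i * (1 + d)" unfolding fl_round_def by blast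
  have "\<bar>z - x $ i * y $ i\<bar> = \<bar>d\<bar> * \<bar>x $ i * y $ i\<bar>"
    unfolding d(2) by (simp add: algebra_simps abs_mult)
  also have "\<dots> \<le> u * \<bar>x $ i * y $ i\<bar>" using d by (intro mult_right_mono) auto
  finally show ?case by simp
next
  case (fl_inner_sum S a T b z)
  let ?X = "\<lambda>S. \<Sum>i\<in>S. x $ i * y $ i" and ?A = "\<lambda>S. \<Sum>i\<in>S. \<bar>x $ i * y $ i\<bar>"
  let ?g = "\<lambda>k. (1 + u) ^ k - 1"
  have fin: "finite S" "finite T" and ne: "S \<noteq> {}" "T \<noteq> {}"
    and a: "\<bar>a - ?X S\<bar> \<le> ?g (card S) * ?A S" and b: "\<bar>b - ?X T\<bar> \<le> ?g (card T) * ?A T"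
    using fl_inner_sum.IH by auto
  obtain d where d: "\<bar>d\<bar> \<le> u" "z = (a + b) * (1 + d)" using fl_inner_sum.hyps unfolding fl_round_def by blast
  have card: "card (S \<union> T) = card S + card T" "1 \<le> card S" "1 \<le> card T"
    using fl_inner_sum.hyps fin ne by (auto simp: card_Un_disjoint Suc_le_eq card_gt_0_iff)
  have X: "?X (S \<union> T) = ?X S + ?X T" and A: "?A (S \<union> T) = ?A S + ?A T"
    using fl_inner_sum.hyps fin by (auto simp: sum.union_disjoint)
  define N where "N = card (S \<union> T)"
  \<comment> \<open>One more rounding turns (1+u)^k - 1 into (1+u)^(k+1) - 1. The exponent stays
    within \<open>N\<close> because the other subtree is nonempty.\<close>
  have part: "(1 + u) * (?g k * ?A R) + u * ?A R \<le> ?g N * ?A R" if "k + 1 \<le> N" for k R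
  proof -
    have "(1 + u) * (?g k * ?A R) + u * ?A R = ?g (k + 1) * ?A R" by (simp add: algebra_simps)
    also have "\<dots> \<le> ?g N * ?A R"
      using power_increasing[OF that, of "1 + u"] assms(2)
      by (intro mult_right_mono) (auto intro: sum_nonneg)
    finally show ?thesis .
  qed
  have XA: "\<bar>?X R\<bar> \<le> ?A R" for R by (rule sum_abs)
  \<comment> \<open>The errors inherited from the subtrees are amplified by 1 + d, whereas the new
    rounding acts on the exact partial sums.\<close>
  have split: "z - ?X (S \<union> T) = (1 + d) * (a - ?X S) + (1 + d) * (b - ?X T) + d * ?X S + d * ?X T"
    unfolding d(2) X by (simp add: algebra_simps)
  have "\<bar>z - ?X (S \<union> T)\<bar> \<le> \<bar>1 + d\<bar> * \<bar>a - ?X S\<bar> + \<bar>1 + d\<bar> * \<bar>b - ?X T\<bar> + \<bar>d\<bar> * \<bar>?X S\<bar> + \<bar>d\<bar> * \<bar>?X T\<bar>"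
    unfolding split by (simp only: flip: abs_mult; linarith)
  also have "\<dots> \<le> (1 + u) * (?g (card S) * ?A S) + (1 + u) * (?g (card T) * ?A T) + u * ?A S + u * ?A T"
    using d(1) assms(2) a b XA by (intro add_mono mult_mono) auto
  also have "\<dots> \<le> ?g N * ?A S + ?g N * ?A T"
    using part[of "card S" S] part[of "card T" T] card by (simp add: N_def)
  also have "\<dots> = ?g N * ?A (S \<union> T)" unfolding A by (simp add: algebra_simps)
  finally show ?case using fin ne N_def by simp
qed

text \<open>For x = N u in [0, 1] one has exp x \<le> 1 + x + x^2 \<le> 1 + 2 x, so the error is
  linear in \<open>u\<close>, as a polynomial multiple of \<open>u\<close> requires.\<close>

lemma power_one_plus_le:
  assumes "0 \<le> u" "real N * u \<le> 1"
  shows "(1 + u) ^ N - 1 \<le> 2 * real N * u"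
proof -
  have "(1 + u) ^ N \<le> exp u ^ N" using assms(1) by (intro power_mono) auto
  also have "\<dots> = exp (real N * u)" by (simp add: exp_of_nat_mult)
  also have "\<dots> \<le> 1 + real N * u + (real N * u)\<^sup>2" using assms by (intro exp_bound) auto
  also have "(real N * u)\<^sup>2 \<le> real N * u" using assms by (simp add: power2_eq_square mult_left_le)
  finally show ?thesis by (simp add: algebra_simps)
qed

text \<open>The factor \<open>n\<close> arises from bounding the norm of the error by the sum of its
  \<open>n\<close> entries; being polynomial, it can be absorbed in gamma.\<close>

lemma fl_mult_mat_vec_error:
  assumes fl: "fl_mult_mat_vec u M x y" and M: "M \<in> carrier_mat n N" and x: "x \<in> carrier_vec N"
    and u: "0 \<le> u" "real N * u \<le> 1"
    and c: "\<And>j. j < n \<Longrightarrow> vec_norm2 (row M j) \<le> c"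
  shows "y \<in> carrier_vec n" "vec_norm2 (y - M *\<^sub>v x) \<le> 2 * real n * real N * u * (c * vec_norm2 x)"
proof -
  show y: "y \<in> carrier_vec n" using fl M unfolding fl_mult_mat_vec_def by simp
  have "\<bar>(y - M *\<^sub>v x) $ j\<bar> \<le> 2 * real N * u * (c * vec_norm2 x)" if j: "j < n" for j
  proof -
    let ?a = "vec N (\<lambda>i. \<bar>row M j $ i\<bar>)" and ?b = "vec N (\<lambda>i. \<bar>x $ i\<bar>)"
    have "fl_inner u (row M j) x {..<N} (y $ j)"
      using fl M x j unfolding fl_mult_mat_vec_def by auto
    from fl_inner_error[OF this u(1)]
    have "\<bar>y $ j - (\<Sum>i<N. row M j $ i * x $ i)\<bar> \<le> ((1 + u) ^ N - 1) * (\<Sum>i<N. \<bar>row M j $ i * x $ i\<bar>)"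
      by simp
    also have "(\<Sum>i<N. row M j $ i * x $ i) = (M *\<^sub>v x) $ j"
      using M x j by (simp add: scalar_prod_def lessThan_atLeast0)
    also have "(\<Sum>i<N. \<bar>row M j $ i * x $ i\<bar>) = ?a \<bullet> ?b"
      by (simp add: scalar_prod_def lessThan_atLeast0 abs_mult)
    also have "((1 + u) ^ N - 1) * (?a \<bullet> ?b) \<le> (2 * real N * u) * (vec_norm2 (row M j) * vec_norm2 x)"
    proof (intro mult_mono)
      have "?a \<bullet> ?b \<le> vec_norm2 ?a * vec_norm2 ?b"
        using scalar_prod_le_vec_norm2[of ?a N ?b] by simp
      also have "\<dots> \<le> vec_norm2 (row M j) * vec_norm2 x"
        using M x j by (intro mult_mono vec_norm2_mono) auto
      finally show "?a \<bullet> ?b \<le> vec_norm2 (row M j) * vec_norm2 x" .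
      show "0 \<le> ?a \<bullet> ?b" by (auto simp: scalar_prod_def intro!: sum_nonneg)
    qed (use u power_one_plus_le in auto)
    also have "\<dots> \<le> (2 * real N * u) * (c * vec_norm2 x)"
      using c[OF j] u by (intro mult_left_mono mult_right_mono) auto
    finally show ?thesis using y M j by simp
  qed
  then have "(\<Sum>j<n. \<bar>(y - M *\<^sub>v x) $ j\<bar>) \<le> (\<Sum>j<n. 2 * real N * u * (c * vec_norm2 x))"
    by (intro sum_mono) auto
  then show "vec_norm2 (y - M *\<^sub>v x) \<le> 2 * real n * real N * u * (c * vec_norm2 x)"
    using vec_norm2_le_sum_abs[of "y - M *\<^sub>v x"] y M by (simp add: mult.assoc mult.left_commute)
qed

section \<open>Submatrices and oblique projectors\<close>

text \<open>Rows of the identity matrix: extracting a submatrix becomes a product with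
  \<open>select_mat\<close> or its transpose, so that associativity replaces index
  computations.\<close>

definition select_mat :: "nat \<Rightarrow> nat set \<Rightarrow> real mat" where
  "select_mat n J = submatrix (1\<^sub>m n) J UNIV"

lemma select_mat_carrier:
  assumes "J \<subseteq> {..<n}"
  shows "select_mat n J \<in> carrier_mat (card J) n"
proof -
  have "card {i. i < n \<and> i \<in> J} = card J" using assms by (auto intro: arg_cong[of _ _ card])
  then show ?thesis by (intro carrier_matI) (simp_all add: select_mat_def dim_submatrix)
qed

lemma row_select_mat:
  assumes "J \<subseteq> {..<n}" "i < card J"
  shows "row (select_mat n J) i = unit_vec n (pick J i)" "pick J i < n"
proof -
  have J: "card {i. i < n \<and> i \<in> J} = card J" using assms by (auto intro: arg_cong[of _ _ card])
  then show "pick J i < n" using pick_le[of i n J] assms by simp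
  then show "row (select_mat n J) i = unit_vec n (pick J i)"
    using row_submatrix_UNIV[of i "1\<^sub>m n :: real mat" J] assms J by (simp add: select_mat_def)
qed

lemma submatrix_rows_eq_select_mat:
  assumes A: "A \<in> carrier_mat m n" and I: "I \<subseteq> {..<m}"
  shows "submatrix A I UNIV = select_mat m I * A"
proof (intro eq_matI)
  have J: "card {i. i < m \<and> i \<in> I} = card I" using I by (auto intro: arg_cong[of _ _ card])
  note K = select_mat_carrier[OF I]
  show "dim_row (submatrix A I UNIV) = dim_row (select_mat m I * A)"
    "dim_col (submatrix A I UNIV) = dim_col (select_mat m I * A)"
    using A J K by (auto simp: dim_submatrix)
  fix i j assume "i < dim_row (select_mat m I * A)" "j < dim_col (select_mat m I * A)"
  then have ij: "i < card I" "j < n" using A K by auto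
  have "submatrix A I UNIV $$ (i, j) = A $$ (pick I i, j)"
    using ij A J by (subst submatrix_index) (auto simp: pick_UNIV)
  also have "\<dots> = (select_mat m I * A) $$ (i, j)"
    using ij A K row_select_mat[OF I ij(1)] by simp
  finally show "submatrix A I UNIV $$ (i, j) = (select_mat m I * A) $$ (i, j)" .
qed

lemma submatrix_cols_eq_select_mat:
  fixes A :: "real mat"
  assumes A: "A \<in> carrier_mat m n" and J: "J \<subseteq> {..<n}"
  shows "submatrix A UNIV J = A * transpose_mat (select_mat n J)"
proof (intro eq_matI)
  have J': "card {i. i < n \<and> i \<in> J} = card J" using J by (auto intro: arg_cong[of _ _ card])
  note K = select_mat_carrier[OF J]
  show "dim_row (submatrix A UNIV J) = dim_row (A * transpose_mat (select_mat n J))"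
    "dim_col (submatrix A UNIV J) = dim_col (A * transpose_mat (select_mat n J))"
    using A J' K by (auto simp: dim_submatrix)
  fix i j assume "i < dim_row (A * transpose_mat (select_mat n J))"
    "j < dim_col (A * transpose_mat (select_mat n J))"
  then have ij: "i < m" "j < card J" using A K by auto
  have "submatrix A UNIV J $$ (i, j) = A $$ (i, pick J j)"
    using ij A J' by (subst submatrix_index) (auto simp: pick_UNIV)
  also have "\<dots> = (A * transpose_mat (select_mat n J)) $$ (i, j)"
    using ij A K row_select_mat[OF J ij(2)] by simp
  finally show "submatrix A UNIV J $$ (i, j) = (A * transpose_mat (select_mat n J)) $$ (i, j)" .
qed

lemma submatrix_eq_select_mat:
  assumes A: "A \<in> carrier_mat m n" and I: "I \<subseteq> {..<m}" and J: "J \<subseteq> {..<n}"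
  shows "submatrix A I J = select_mat m I * (A * transpose_mat (select_mat n J))"
proof -
  have "A * transpose_mat (select_mat n J) \<in> carrier_mat m (card J)"
    using A select_mat_carrier[OF J] by simp
  then show ?thesis
    by (simp add: submatrix_split[of A I J] submatrix_cols_eq_select_mat[OF A J]
        submatrix_rows_eq_select_mat[OF _ I])
qed

lemma select_mat_mult_vec_index:
  assumes "J \<subseteq> {..<n}" "x \<in> carrier_vec n" "i < card J"
  shows "(select_mat n J *\<^sub>v x) $ i = x $ pick J i"
  using assms row_select_mat[OF assms(1,3)] select_mat_carrier[OF assms(1)] by simp

text \<open>An element l of \<open>I\<close> stands in \<open>I'\<close> at the position that counts
  the smaller elements of \<open>I'\<close>, so the entry at l vanishes. This carries nonsingularity
  at the rows \<open>I\<close> over to the larger set \<open>I'\<close>.\<close>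

lemma select_mat_mult_vec_eq_0_mono:
  assumes I: "I \<subseteq> I'" and I': "I' \<subseteq> {..<m}" and x: "x \<in> carrier_vec m"
    and zero: "select_mat m I' *\<^sub>v x = 0\<^sub>v (card I')"
  shows "select_mat m I *\<^sub>v x = 0\<^sub>v (card I)"
proof (intro eq_vecI)
  have Im: "I \<subseteq> {..<m}" using I I' by auto
  have fin: "finite I'" "finite I" using I' Im finite_subset by blast+
  fix i assume "i < dim_vec (0\<^sub>v (card I) :: real vec)"
  then have i: "i < card I" by simp
  define l where "l = pick I i"
  have l: "l \<in> I'" using pick_in_set_le[OF i] I unfolding l_def by auto
  have "{a \<in> I'. a < l} \<subset> I'" using l by auto
  then have "card {a \<in> I'. a < l} < card I'" using fin psubset_card_mono by blast
  then have "x $ pick I' (card {a \<in> I'. a < l}) = 0"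
    using select_mat_mult_vec_index[OF I' x] zero by simp
  then have "x $ l = 0" using pick_card_in_set[OF l] by simp
  then show "(select_mat m I *\<^sub>v x) $ i = 0\<^sub>v (card I) $ i"
    using select_mat_mult_vec_index[OF Im x i] i by (simp add: l_def)
next
  have "I \<subseteq> {..<m}" using I I' by auto
  from select_mat_carrier[OF this]
  show "dim_vec (select_mat m I *\<^sub>v x) = dim_vec (0\<^sub>v (card I) :: real vec)" by simp
qed

text \<open>\<open>pick J\<close> is injective, so the selected entries are distinct entries of
  \<open>x\<close> and their squares sum to at most |x|^2.\<close>

lemma select_mat_contraction:
  assumes J: "J \<subseteq> {..<n}" and x: "x \<in> carrier_vec n"
  shows "vec_norm2 (select_mat n J *\<^sub>v x) \<le> vec_norm2 x"
proof (rule power2_le_imp_le)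
  have fin: "finite J" using J finite_subset by blast
  have K: "select_mat n J \<in> carrier_mat (card J) n" using select_mat_carrier[OF J] .
  have inj: "inj_on (pick J) {0..<card J}"
    using pick_mono_le[of _ J] by (intro linorder_inj_onI) (auto simp: less_le)
  have "(vec_norm2 (select_mat n J *\<^sub>v x))\<^sup>2 = (\<Sum>i\<in>{0..<card J}. (x $ pick J i)\<^sup>2)"
    using K select_mat_mult_vec_index[OF J x] unfolding vec_norm2_sq
    by (simp add: scalar_prod_def[of "select_mat n J *\<^sub>v x"] power2_eq_square)
  also have "\<dots> = (\<Sum>j\<in>pick J ` {0..<card J}. (x $ j)\<^sup>2)"
    by (simp add: sum.reindex[OF inj])
  also have "\<dots> \<le> (\<Sum>j\<in>{0..<n}. (x $ j)\<^sup>2)"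
    using row_select_mat(2)[OF J] by (intro sum_mono2) auto
  also have "\<dots> = (vec_norm2 x)\<^sup>2"
    using x unfolding vec_norm2_sq by (simp add: scalar_prod_def power2_eq_square)
  finally show "(vec_norm2 (select_mat n J *\<^sub>v x))\<^sup>2 \<le> (vec_norm2 x)\<^sup>2" .
qed simp

lemma select_mat_transpose_contraction:
  assumes J: "J \<subseteq> {..<n}" and y: "y \<in> carrier_vec (card J)"
  shows "vec_norm2 (transpose_mat (select_mat n J) *\<^sub>v y) \<le> vec_norm2 y"
  using mult_mat_vec_transpose_bound[OF select_mat_carrier[OF J] y, of 1]
    select_mat_contraction[OF J] by simp

text \<open>
  An oblique projector and its complement have the same norm. The vector \<open>x'\<close> below is obtained from
  the splitting \<open>x = a + v\<close> by exchanging the lengths of the two parts, which does not change the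
  length of the sum.
\<close>

lemma smult_zero_vec: "c \<cdot>\<^sub>v 0\<^sub>v n = (0\<^sub>v n :: real vec)"
  by (intro eq_vecI) auto

lemma oblique_projector_complement_bound:
  fixes L K :: "real mat"
  assumes L: "L \<in> carrier_mat n k" and K: "K \<in> carrier_mat k n"
    and KL: "\<And>y. y \<in> carrier_vec k \<Longrightarrow> K *\<^sub>v (L *\<^sub>v y) = y"
    and Kb: "\<And>x. x \<in> carrier_vec n \<Longrightarrow> vec_norm2 (K *\<^sub>v x) \<le> vec_norm2 x"
    and Lb: "\<And>y. y \<in> carrier_vec k \<Longrightarrow> vec_norm2 (L *\<^sub>v y) \<le> \<nu> * vec_norm2 y"
    and nu: "1 \<le> \<nu>" and x: "x \<in> carrier_vec n"
  shows "vec_norm2 (x - L *\<^sub>v (K *\<^sub>v x)) \<le> \<nu> * vec_norm2 x"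
proof -
  define a v where "a = L *\<^sub>v (K *\<^sub>v x)" and "v = x - a"
  have Kx: "K *\<^sub>v x \<in> carrier_vec k" using K x by simp
  have a: "a \<in> carrier_vec n" using L K x by (simp add: a_def)
  have v: "v \<in> carrier_vec n" using a x by (simp add: v_def)
  have x_eq: "x = a + v" using a x by (auto simp: v_def)
  have Ka: "K *\<^sub>v a = K *\<^sub>v x" using KL[OF Kx] by (simp add: a_def)
  have Kv: "K *\<^sub>v v = 0\<^sub>v k" using mult_minus_distrib_mat_vec[OF K x a] Ka Kx by (simp add: v_def)
  show ?thesis
  proof (cases "vec_norm2 a = 0 \<or> vec_norm2 v = 0")
    case True
    moreover have "vec_norm2 v \<le> \<nu> * vec_norm2 x" if "vec_norm2 a = 0"
    proof -
      have "a = 0\<^sub>v n" using that vec_norm2_eq_0_iff[OF a] by simp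
      then have "v = x" using x by (auto simp: v_def)
      then show ?thesis using mult_right_mono[OF nu vec_norm2_nonneg[of x]] by simp
    qed
    ultimately show ?thesis using nu by (fold a_def v_def) auto
  next
    case False
    then have pos: "0 < vec_norm2 a" "0 < vec_norm2 v"
      using vec_norm2_nonneg[of a] vec_norm2_nonneg[of v] by linarith+
    define s where "s = vec_norm2 v / vec_norm2 a"
    have s: "0 < s" using pos by (simp add: s_def)
    define x' where "x' = s \<cdot>\<^sub>v a + (1 / s) \<cdot>\<^sub>v v"
    have sa: "s \<cdot>\<^sub>v a \<in> carrier_vec n" and sv: "(1 / s) \<cdot>\<^sub>v v \<in> carrier_vec n" using a v by auto
    have x': "x' \<in> carrier_vec n" using a v by (simp add: x'_def)
    have expand: "(p + q) \<bullet> (p + q) = p \<bullet> p + 2 * (p \<bullet> q) + q \<bullet> q"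
      if "p \<in> carrier_vec n" "q \<in> carrier_vec n" for p q :: "real vec"
      using that comm_scalar_prod[of p n q]
      by (simp add: add_scalar_prod_distrib[of _ n] scalar_prod_add_distrib[of _ n])
    \<comment> \<open>The factors s and 1/s cancel in the cross term, and the two squared lengths
      change places.\<close>
    have "x' \<bullet> x' = s\<^sup>2 * (a \<bullet> a) + 2 * (a \<bullet> v) + (1 / s)\<^sup>2 * (v \<bullet> v)"
      unfolding x'_def expand[OF sa sv] using a v s by (simp add: power2_eq_square)
    also have "\<dots> = a \<bullet> a + 2 * (a \<bullet> v) + v \<bullet> v"
      unfolding vec_norm2_sq[symmetric] s_def using pos by (simp add: field_simps)
    also have "\<dots> = x \<bullet> x" unfolding x_eq expand[OF a v] ..
    finally have norm_x': "vec_norm2 x' = vec_norm2 x" by (simp add: vec_norm2_def)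
    have "K *\<^sub>v x' = K *\<^sub>v (s \<cdot>\<^sub>v a) + K *\<^sub>v ((1 / s) \<cdot>\<^sub>v v)"
      unfolding x'_def by (rule mult_add_distrib_mat_vec[OF K sa sv])
    also have "\<dots> = s \<cdot>\<^sub>v (K *\<^sub>v x)"
      unfolding mult_mat_vec[OF K a] mult_mat_vec[OF K v] Ka Kv smult_zero_vec using Kx by simp
    finally have "L *\<^sub>v (K *\<^sub>v x') = s \<cdot>\<^sub>v a" using mult_mat_vec[OF L Kx] by (simp add: a_def)
    \<comment> \<open>The projector maps x' to s a, whose length is that of \<open>v\<close> by the
      choice of \<open>s\<close>.\<close>
    then have "vec_norm2 v = vec_norm2 (L *\<^sub>v (K *\<^sub>v x'))"
      using pos s by (simp add: vec_norm2_smult s_def)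
    also have "\<dots> \<le> \<nu> * vec_norm2 (K *\<^sub>v x')" using Lb[of "K *\<^sub>v x'"] K x' by simp
    also have "\<dots> \<le> \<nu> * vec_norm2 x'" using Kb[OF x'] nu by (intro mult_left_mono) auto
    finally show ?thesis unfolding norm_x' v_def a_def .
  qed
qed

section \<open>Products with the pseudoinverse of a nearby matrix\<close>

lemma vec_add_diff_rearrange:
  fixes a b c d :: "real vec"
  assumes "a \<in> carrier_vec n" "b \<in> carrier_vec n" "c \<in> carrier_vec n" "d \<in> carrier_vec n"
  shows "(a + b) - (a + c + d) = (b - c) - d"
  using assms by (intro eq_vecI) auto

text \<open>With P the pseudoinverse of \<open>G\<close> and B = G + D, the products B P and P B are
  an orthogonal projector plus a term of size \<delta> \<rho>, so the norm of \<open>B\<close> never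
  enters. For the last bound put y = D x and g = P G x: since G g = G x, the difference is y - D g -
  B P y, and the three terms give 1 + 1 + (1 + \<delta> \<rho>).\<close>

lemma perturbed_pinv_bounds:
  fixes G D :: "real mat"
  assumes G: "G \<in> carrier_mat k N" and B: "B \<in> carrier_mat k N"
    and P\<rho>: "\<And>y. y \<in> carrier_vec k \<Longrightarrow> vec_norm2 (pinv G *\<^sub>v y) \<le> \<rho> * vec_norm2 y"
    and BG: "\<And>x. x \<in> carrier_vec N \<Longrightarrow> vec_norm2 (B *\<^sub>v x - G *\<^sub>v x) \<le> \<delta> * vec_norm2 x"
    and nonneg: "0 \<le> \<delta>" "0 \<le> \<rho>"
  shows "y \<in> carrier_vec k \<Longrightarrow> vec_norm2 (B *\<^sub>v (pinv G *\<^sub>v y)) \<le> (1 + \<delta> * \<rho>) * vec_norm2 y"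
    and "x \<in> carrier_vec N \<Longrightarrow> vec_norm2 (pinv G *\<^sub>v (B *\<^sub>v x)) \<le> (1 + \<delta> * \<rho>) * vec_norm2 x"
    and "x \<in> carrier_vec N \<Longrightarrow>
      vec_norm2 (B *\<^sub>v x - B *\<^sub>v (pinv G *\<^sub>v (B *\<^sub>v x))) \<le> \<delta> * (3 + \<delta> * \<rho>) * vec_norm2 x"
proof -
  define D where "D x = B *\<^sub>v x - G *\<^sub>v x" for x
  let ?P = "pinv G"
  note P = pinv_carrier[OF G]
  note mc = mult_mat_vec_carrier
  have D: "D x \<in> carrier_vec k" and B_eq: "B *\<^sub>v x = G *\<^sub>v x + D x"
    and Db: "vec_norm2 (D x) \<le> \<delta> * vec_norm2 x" if "x \<in> carrier_vec N" for x
  proof -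
    show "D x \<in> carrier_vec k" using B G that by (simp add: D_def)
    show "B *\<^sub>v x = G *\<^sub>v x + D x" using B G that by (auto simp: D_def)
    show "vec_norm2 (D x) \<le> \<delta> * vec_norm2 x" using BG[OF that] by (simp add: D_def)
  qed
  have DP: "vec_norm2 (D (?P *\<^sub>v y)) \<le> \<delta> * \<rho> * vec_norm2 y" if y: "y \<in> carrier_vec k" for y
    using order.trans[OF Db[OF mc[OF P y]] mult_left_mono[OF P\<rho>[OF y] nonneg(1)]] by (simp add: mult.assoc)
  show 1: "vec_norm2 (B *\<^sub>v (?P *\<^sub>v y)) \<le> (1 + \<delta> * \<rho>) * vec_norm2 y" if y: "y \<in> carrier_vec k" for y
  proof -
    have Py: "?P *\<^sub>v y \<in> carrier_vec N" using P y by simp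
    have "vec_norm2 (B *\<^sub>v (?P *\<^sub>v y)) \<le> vec_norm2 y + \<delta> * \<rho> * vec_norm2 y"
      unfolding B_eq[OF Py]
      by (rule vec_norm2_add_le[OF mc[OF G Py] D[OF Py] mult_pinv_contraction[OF G y] DP[OF y]])
    then show ?thesis by (simp add: algebra_simps)
  qed
  show 2: "vec_norm2 (?P *\<^sub>v (B *\<^sub>v x)) \<le> (1 + \<delta> * \<rho>) * vec_norm2 x" if x: "x \<in> carrier_vec N" for x
  proof -
    have Gx: "G *\<^sub>v x \<in> carrier_vec k" using G x by simp
    have "?P *\<^sub>v (B *\<^sub>v x) = ?P *\<^sub>v (G *\<^sub>v x) + ?P *\<^sub>v D x"
      unfolding B_eq[OF x] by (rule mult_add_distrib_mat_vec[OF P Gx D[OF x]])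
    moreover have "vec_norm2 (?P *\<^sub>v D x) \<le> \<rho> * (\<delta> * vec_norm2 x)"
      using order.trans[OF P\<rho>[OF D[OF x]] mult_left_mono[OF Db[OF x] nonneg(2)]] .
    ultimately have "vec_norm2 (?P *\<^sub>v (B *\<^sub>v x)) \<le> vec_norm2 x + \<rho> * (\<delta> * vec_norm2 x)"
      using vec_norm2_add_le[OF mc[OF P Gx] mc[OF P D[OF x]] pinv_mult_contraction[OF G x]] by simp
    then show ?thesis by (simp add: algebra_simps)
  qed
  show "vec_norm2 (B *\<^sub>v x - B *\<^sub>v (?P *\<^sub>v (B *\<^sub>v x))) \<le> \<delta> * (3 + \<delta> * \<rho>) * vec_norm2 x"
    if x: "x \<in> carrier_vec N" for x
  proof -
    define y where "y = D x"
    define g where "g = ?P *\<^sub>v (G *\<^sub>v x)"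
    have Gx: "G *\<^sub>v x \<in> carrier_vec k" using G x by simp
    have y: "y \<in> carrier_vec k" using D[OF x] by (simp add: y_def)
    have g: "g \<in> carrier_vec N" using P Gx by (simp add: g_def)
    have BPy: "B *\<^sub>v (?P *\<^sub>v y) \<in> carrier_vec k" using B P y by simp
    have Gg: "G *\<^sub>v g = G *\<^sub>v x" using mult_pinv_mult_vec[OF G x] by (simp add: g_def)
    have "B *\<^sub>v (?P *\<^sub>v (B *\<^sub>v x)) = B *\<^sub>v (g + ?P *\<^sub>v y)"
      unfolding B_eq[OF x] mult_add_distrib_mat_vec[OF P Gx D[OF x]] by (simp add: g_def y_def)
    also have "\<dots> = (G *\<^sub>v x + D g) + B *\<^sub>v (?P *\<^sub>v y)"
      using mult_add_distrib_mat_vec[OF B g mc[OF P y]] B_eq[OF g] Gg by simp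
    finally have "B *\<^sub>v x - B *\<^sub>v (?P *\<^sub>v (B *\<^sub>v x)) = (y - D g) - B *\<^sub>v (?P *\<^sub>v y)"
      unfolding B_eq[OF x, folded y_def] using vec_add_diff_rearrange[OF Gx y D[OF g] BPy] by simp
    also have "vec_norm2 \<dots> \<le> (\<delta> * vec_norm2 x + \<delta> * vec_norm2 x) + (1 + \<delta> * \<rho>) * (\<delta> * vec_norm2 x)"
    proof (rule vec_norm2_diff_le[OF _ BPy])
      show "y - D g \<in> carrier_vec k" using y D[OF g] by simp
      have "vec_norm2 g \<le> vec_norm2 x" using pinv_mult_contraction[OF G x] by (simp add: g_def)
      then show "vec_norm2 (y - D g) \<le> \<delta> * vec_norm2 x + \<delta> * vec_norm2 x"
        using Db[OF x] order.trans[OF Db[OF g] mult_left_mono[OF _ nonneg(1)]]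
        by (intro vec_norm2_diff_le[OF y D[OF g]]) (auto simp: y_def)
      have "vec_norm2 (B *\<^sub>v (?P *\<^sub>v y)) \<le> (1 + \<delta> * \<rho>) * vec_norm2 y" by (rule 1[OF y])
      also have "\<dots> \<le> (1 + \<delta> * \<rho>) * (\<delta> * vec_norm2 x)"
        using Db[OF x] nonneg by (intro mult_left_mono) (auto simp: y_def)
      finally show "vec_norm2 (B *\<^sub>v (?P *\<^sub>v y)) \<le> (1 + \<delta> * \<rho>) * (\<delta> * vec_norm2 x)" .
    qed
    also have "\<dots> = \<delta> * (3 + \<delta> * \<rho>) * vec_norm2 x" by (simp add: algebra_simps)
    finally show ?thesis .
  qed
qed

section \<open>Interpolation by selected rows and columns\<close>

lemma invertible_mat_imp_inj_mat:
  fixes M :: "real mat"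
  assumes M: "M \<in> carrier_mat n n" and inv: "invertible_mat M"
  shows "inj_mat M"
proof -
  obtain B where B: "M * B = 1\<^sub>m n" "B * M = 1\<^sub>m (dim_row B)"
    using M inv unfolding invertible_mat_def inverts_mat_def by auto
  have "dim_col B = n" using arg_cong[OF B(1), of dim_col] by simp
  moreover have "dim_row B = n" using arg_cong[OF B(2), of dim_col] M by simp
  ultimately show ?thesis using left_inverse_imp_inj_mat[OF M, of B] B(2) by auto
qed

lemma square_transpose_inj_mat:
  assumes M: "M \<in> carrier_mat n n" and inj: "inj_mat M"
  shows "inj_mat (transpose_mat M)"
proof -
  obtain B where B: "B \<in> carrier_mat n n" "M * B = 1\<^sub>m n" using inj_mat_square_inverse[OF M inj] by blast
  have "transpose_mat B * transpose_mat M = 1\<^sub>m n" using transpose_mult[OF M B(1)] B(2) by simp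
  then show ?thesis using left_inverse_imp_inj_mat[of "transpose_mat M" n n "transpose_mat B"] M B(1) by simp
qed

lemma row_eq_transpose_mult:
  fixes A :: "real mat"
  assumes "A \<in> carrier_mat m n" "i < m"
  shows "row A i = transpose_mat A *\<^sub>v unit_vec m i"
  using mult_mat_unit_vec[of "transpose_mat A" n m i] assms by simp

lemma orthonormal_columns_row_le:
  assumes "Q \<in> carrier_mat m k" "orthonormal_columns Q" "i < m"
  shows "vec_norm2 (row Q i) \<le> 1"
  using orthonormal_columns_transpose_contraction[OF assms(1,2), of "unit_vec m i"]
    row_eq_transpose_mult[OF assms(1,3)] assms(3) by simp

lemma vec_diff_add_cancel:
  fixes v w :: "real vec"
  assumes "v \<in> carrier_vec n" "w \<in> carrier_vec n"
  shows "v - w + w = v"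
  using assms by (intro eq_vecI) auto

lemma vec_add_diff_rearrange':
  fixes a b c :: "real vec"
  assumes "a \<in> carrier_vec n" "b \<in> carrier_vec n" "c \<in> carrier_vec n"
  shows "(a + b) - (c + b) = a - c"
  using assms by (intro eq_vecI) auto

text \<open>The projector L K reproduces the range of \<open>Q\<close>, which is the row space of
  \<open>X\<close>. Hence only the part of A^T z coming from the residual A (1 - X^+ X) is left, and
  the complementary projector enlarges it by at most the norm of \<open>L\<close>.\<close>

lemma row_space_interpolation:
  assumes A: "A \<in> carrier_mat m n" and J: "J \<subseteq> {..<n}" "card J = k" and k: "0 < k"
    and X: "X \<in> carrier_mat k n" and rank: "mat_rank (submatrix X UNIV J) = k"
    and Q: "Q \<in> carrier_mat n k" and orth: "orthonormal_columns Q"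
    and col: "column_space Q = column_space (transpose_mat X)"
  obtains L where "L \<in> carrier_mat n k"
    "\<And>y. y \<in> carrier_vec k \<Longrightarrow> vec_norm2 (L *\<^sub>v y) \<le> spec_norm (pinv (submatrix Q J UNIV)) * vec_norm2 y"
    "\<And>z. z \<in> carrier_vec m \<Longrightarrow>
       vec_norm2 (transpose_mat A *\<^sub>v z - L *\<^sub>v (select_mat n J *\<^sub>v (transpose_mat A *\<^sub>v z)))
         \<le> spec_norm (pinv (submatrix Q J UNIV)) * frob_norm (A * (1\<^sub>m n - pinv X * X)) * vec_norm2 z"
proof -
  define K where "K = select_mat n J"
  define V where "V = K * Q"
  define \<nu> where "\<nu> = spec_norm (pinv (submatrix Q J UNIV))"
  have K: "K \<in> carrier_mat k n" using select_mat_carrier[OF J(1)] J(2) by (simp add: K_def)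
  have V: "V \<in> carrier_mat k k" using K Q by (simp add: V_def)
  have sub_Q: "submatrix Q J UNIV = V"
    using submatrix_rows_eq_select_mat[OF Q J(1)] by (simp add: V_def K_def)
  have XT: "transpose_mat X \<in> carrier_mat n k" using X by simp
  obtain M where M: "M \<in> carrier_mat k k" "transpose_mat X = Q * M"
    using column_space_subset_factor[OF XT Q] col by auto
  have XK: "submatrix X UNIV J = X * transpose_mat K"
    using submatrix_cols_eq_select_mat[OF X J(1)] by (simp add: K_def)
  have XKc: "X * transpose_mat K \<in> carrier_mat k k" using X K by simp
  have "X * transpose_mat K = transpose_mat (K * transpose_mat X)"
    using transpose_mult[OF K XT] by simp
  also have "K * transpose_mat X = V * M" unfolding M(2) V_def using K Q M(1) by simp
  also have "transpose_mat (V * M) = transpose_mat M * transpose_mat V" by (rule transpose_mult[OF V M(1)])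
  finally have "X * transpose_mat K = transpose_mat M * transpose_mat V" .
  \<comment> \<open>Full rank of X(:,J) passes to its right factor V^T, which makes \<open>V\<close>
    invertible.\<close>
  moreover have "inj_mat (X * transpose_mat K)"
    using full_rank_square_inj_mat[OF XKc] rank[unfolded XK] by simp
  ultimately have "inj_mat (transpose_mat V)"
    using inj_mat_mult_right[of "transpose_mat M" "transpose_mat V" k k k] M V by simp
  then have "inj_mat V" using square_transpose_inj_mat[of "transpose_mat V" k] V by simp
  then have PV: "pinv V * V = 1\<^sub>m k" using pinv_left_inverse[OF V] by simp
  have P: "pinv V \<in> carrier_mat k k" using pinv_carrier[OF V] .
  have VP: "V * pinv V = 1\<^sub>m k" using mat_mult_left_right_inverse[OF P V PV] .
  define L where "L = Q * pinv V"
  have L: "L \<in> carrier_mat n k" using Q P by (simp add: L_def)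
  have Lb: "vec_norm2 (L *\<^sub>v y) \<le> \<nu> * vec_norm2 y" if y: "y \<in> carrier_vec k" for y
  proof -
    have "L *\<^sub>v y = Q *\<^sub>v (pinv V *\<^sub>v y)" using Q P y by (simp add: L_def)
    then have "vec_norm2 (L *\<^sub>v y) = vec_norm2 (pinv V *\<^sub>v y)"
      using orthonormal_columns_norm[OF Q orth] P y by simp
    then show ?thesis using mult_mat_vec_spec_norm[OF P y] by (simp add: \<nu>_def sub_Q)
  qed
  have KL: "K *\<^sub>v (L *\<^sub>v y) = y" if y: "y \<in> carrier_vec k" for y
  proof -
    have "K *\<^sub>v (L *\<^sub>v y) = V *\<^sub>v (pinv V *\<^sub>v y)"
      using K Q P y by (simp add: L_def V_def assoc_mult_mat_vec[of _ k n _ k] assoc_mult_mat_vec[of _ n k _ k])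
    also have "\<dots> = y" using assoc_mult_mat_vec[OF V P y] VP y by simp
    finally show ?thesis .
  qed
  have Kb: "vec_norm2 (K *\<^sub>v x) \<le> vec_norm2 x" if "x \<in> carrier_vec n" for x
    using select_mat_contraction[OF J(1) that] by (simp add: K_def)
  \<comment> \<open>K L is the identity and \<open>K\<close> is a contraction, so \<open>L\<close>
    cannot shrink a unit vector; one exists because k > 0.\<close>
  have nu: "1 \<le> \<nu>"
  proof -
    let ?y = "unit_vec k 0 :: real vec"
    have "vec_norm2 (K *\<^sub>v (L *\<^sub>v ?y)) \<le> vec_norm2 (L *\<^sub>v ?y)" using Kb L by simp
    also have "\<dots> \<le> \<nu> * vec_norm2 ?y" using Lb by simp
    finally show ?thesis using KL[of ?y] k by simp
  qed
  have LQ: "L *\<^sub>v (K *\<^sub>v (Q *\<^sub>v y)) = Q *\<^sub>v y" if y: "y \<in> carrier_vec k" for y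
  proof -
    have "L *\<^sub>v (K *\<^sub>v (Q *\<^sub>v y)) = Q *\<^sub>v (pinv V *\<^sub>v (V *\<^sub>v y))"
      using K Q P y by (simp add: L_def V_def assoc_mult_mat_vec[of _ k n _ k] assoc_mult_mat_vec[of _ n k _ k])
    also have "pinv V *\<^sub>v (V *\<^sub>v y) = y" using assoc_mult_mat_vec[OF P V y] PV y by simp
    finally show ?thesis .
  qed
  define PX where "PX = pinv X"
  have PX: "PX \<in> carrier_mat n k" using pinv_carrier[OF X] by (simp add: PX_def)
  define E where "E = A * (1\<^sub>m n - PX * X)"
  have PXX: "PX * X \<in> carrier_mat n n" using PX X by simp
  have E: "E \<in> carrier_mat m n" unfolding E_def by (rule mult_carrier_mat[OF A minus_carrier_mat[OF PXX]])
  have bound: "vec_norm2 (transpose_mat A *\<^sub>v z - L *\<^sub>v (K *\<^sub>v (transpose_mat A *\<^sub>v z)))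
      \<le> \<nu> * frob_norm E * vec_norm2 z" if z: "z \<in> carrier_vec m" for z
  proof -
    \<comment> \<open>A^T z splits into Q y, its part in the row space of \<open>X\<close>, and the
      residual part \<open>b\<close>.\<close>
    define y where "y = M *\<^sub>v (transpose_mat PX *\<^sub>v (transpose_mat A *\<^sub>v z))"
    define b where "b = transpose_mat E *\<^sub>v z"
    have Az: "transpose_mat A *\<^sub>v z \<in> carrier_vec n" using A z by simp
    have PAz: "transpose_mat PX *\<^sub>v (transpose_mat A *\<^sub>v z) \<in> carrier_vec k" using PX Az by simp
    have y: "y \<in> carrier_vec k" using M PAz by (simp add: y_def)
    have b: "b \<in> carrier_vec n" using E z by (simp add: b_def)
    have Qy: "Q *\<^sub>v y \<in> carrier_vec n" using Q y by simp
    have XPX: "transpose_mat (PX * X) *\<^sub>v (transpose_mat A *\<^sub>v z) = Q *\<^sub>v y"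
    proof -
      have "transpose_mat (PX * X) = (Q * M) * transpose_mat PX"
        using transpose_mult[OF PX X] M(2) by simp
      then show ?thesis
        using Q M(1) PX Az PAz by (simp add: y_def assoc_mult_mat_vec[of _ n k _ n]
            assoc_mult_mat_vec[of _ n k _ k] del: assoc_mult_mat)
    qed
    have "transpose_mat E = transpose_mat (1\<^sub>m n - PX * X) * transpose_mat A"
      unfolding E_def by (rule transpose_mult[OF A minus_carrier_mat[OF PXX]])
    also have "transpose_mat (1\<^sub>m n - PX * X) = 1\<^sub>m n - transpose_mat (PX * X)"
      using transpose_minus[of "1\<^sub>m n" n n "PX * X"] PXX by simp
    finally have "b = (1\<^sub>m n - transpose_mat (PX * X)) *\<^sub>v (transpose_mat A *\<^sub>v z)"
      using assoc_mult_mat_vec[OF minus_carrier_mat, of "transpose_mat (PX * X)" n n "transpose_mat A" m z]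
        A PXX z by (simp add: b_def)
    also have "\<dots> = transpose_mat A *\<^sub>v z - Q *\<^sub>v y"
      using PXX Az XPX minus_mult_distrib_mat_vec[of "1\<^sub>m n" n n "transpose_mat (PX * X)"] by simp
    finally have Az_eq: "transpose_mat A *\<^sub>v z = b + Q *\<^sub>v y" using vec_diff_add_cancel[OF Az Qy] by simp
    have Kc: "K *\<^sub>v b \<in> carrier_vec k" "K *\<^sub>v (Q *\<^sub>v y) \<in> carrier_vec k" using K b Qy by auto
    have "L *\<^sub>v (K *\<^sub>v (b + Q *\<^sub>v y)) = L *\<^sub>v (K *\<^sub>v b) + Q *\<^sub>v y"
      unfolding mult_add_distrib_mat_vec[OF K b Qy] mult_add_distrib_mat_vec[OF L Kc] LQ[OF y] ..
    then have "transpose_mat A *\<^sub>v z - L *\<^sub>v (K *\<^sub>v (transpose_mat A *\<^sub>v z)) = b - L *\<^sub>v (K *\<^sub>v b)"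
      unfolding Az_eq using vec_add_diff_rearrange'[OF b Qy mult_mat_vec_carrier[OF L Kc(1)]] by simp
    moreover have "vec_norm2 (b - L *\<^sub>v (K *\<^sub>v b)) \<le> \<nu> * vec_norm2 b"
      by (rule oblique_projector_complement_bound[OF L K KL Kb Lb nu b])
    moreover have "vec_norm2 b \<le> frob_norm E * vec_norm2 z"
      using mult_mat_vec_frob_norm[of "transpose_mat E" n m z] E z by (simp add: frob_norm_transpose b_def)
    ultimately show ?thesis
      using nu by (smt (verit, best) mult.assoc mult_left_mono)
  qed
  show ?thesis
    by (rule that[OF L Lb[unfolded \<nu>_def] bound[unfolded \<nu>_def E_def PX_def K_def]])
qed

text \<open>With C = Q M and W = Q(I',:) one has U = W M. If q is a row of \<open>Q\<close>, the
  vector w = (W^+)^T q solves U^T w = M^T q because W^+ W = 1, and |q| \<le> 1 bounds w. No inverse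
  of \<open>U\<close> occurs, so its conditioning plays no part in the bound.\<close>

lemma column_space_coefficients:
  assumes A: "A \<in> carrier_mat m n" and J: "J \<subseteq> {..<n}" "card J = k" and k: "0 < k"
    and I: "I \<subseteq> I'" "card I = k" and I': "I' \<subseteq> {..<m}"
    and inv: "invertible_mat (submatrix A I J)"
    and Q: "Q \<in> carrier_mat m k" and orth: "orthonormal_columns Q"
    and col: "column_space Q = column_space (submatrix A UNIV J)"
  shows "1 \<le> spec_norm (pinv (submatrix Q I' UNIV))"
    and "i < m \<Longrightarrow> \<exists>w \<in> carrier_vec (card I').
      vec_norm2 w \<le> spec_norm (pinv (submatrix Q I' UNIV)) \<and>
      transpose_mat (submatrix A I' J) *\<^sub>v w = row (submatrix A UNIV J) i"
proof -
  define C where "C = submatrix A UNIV J"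
  define S where "S = select_mat m I'"
  define N where "N = card I'"
  define W where "W = S * Q"
  have Im: "I \<subseteq> {..<m}" using I I' by auto
  have C_eq: "C = A * transpose_mat (select_mat n J)"
    using submatrix_cols_eq_select_mat[OF A J(1)] by (simp add: C_def)
  have C: "C \<in> carrier_mat m k" using A select_mat_carrier[OF J(1)] J(2) by (simp add: C_eq)
  have S: "S \<in> carrier_mat N m" using select_mat_carrier[OF I'] by (simp add: S_def N_def)
  have SI: "select_mat m I \<in> carrier_mat k m" using select_mat_carrier[OF Im] I(2) by simp
  have W: "W \<in> carrier_mat N k" using S Q by (simp add: W_def)
  have sub_Q: "submatrix Q I' UNIV = W"
    using submatrix_rows_eq_select_mat[OF Q I'] by (simp add: W_def S_def)
  have U_eq: "submatrix A I' J = S * C"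
    using submatrix_eq_select_mat[OF A I' J(1)] by (simp add: S_def C_eq)
  obtain M where M: "M \<in> carrier_mat k k" "C = Q * M"
    using column_space_subset_factor[OF C Q] col by (auto simp: C_def)
  have AIJ: "submatrix A I J = select_mat m I * C"
    using submatrix_eq_select_mat[OF A Im J(1)] by (simp add: C_eq)
  have SIC: "select_mat m I * C \<in> carrier_mat k k" and SIQ: "select_mat m I * Q \<in> carrier_mat k k"
    using SI C Q by auto
  have inj: "inj_mat (select_mat m I * C)"
    using invertible_mat_imp_inj_mat[OF SIC] inv AIJ by simp
  have SIC_eq: "select_mat m I * C = (select_mat m I * Q) * M"
    unfolding M(2) by (rule assoc_mult_mat[OF SI Q M(1), symmetric])
  \<comment> \<open>A(I,J) factors as Q(I,:) M, so its nonsingularity passes first to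
    \<open>M\<close> and then, on multiplying by the inverse of \<open>M\<close>, to Q(I,:).\<close>
  have injM: "inj_mat M" using inj_mat_mult_right[OF _ SIQ M(1)] inj SIC_eq by simp
  obtain M' where M': "M' \<in> carrier_mat k k" "M' * M = 1\<^sub>m k" "M * M' = 1\<^sub>m k"
    using inj_mat_square_inverse[OF M(1) injM] .
  have "inj_mat M'" using left_inverse_imp_inj_mat[OF M'(1) M(1) M'(3)] .
  then have "inj_mat ((select_mat m I * C) * M')" using inj_mat_mult[OF inj _ SIC M'(1)] by simp
  also have "(select_mat m I * C) * M' = select_mat m I * Q"
    unfolding SIC_eq unfolding assoc_mult_mat[OF SIQ M(1) M'(1)] M'(3) by (rule right_mult_one_mat[OF SIQ])
  finally have injSIQ: "inj_mat (select_mat m I * Q)" .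
  have "inj_mat W"
  proof (rule inj_matI[OF W])
    fix x assume x: "x \<in> carrier_vec k" "W *\<^sub>v x = 0\<^sub>v N"
    have Qx: "Q *\<^sub>v x \<in> carrier_vec m" using Q x by simp
    have "select_mat m I' *\<^sub>v (Q *\<^sub>v x) = 0\<^sub>v (card I')"
      using x S Q by (simp add: W_def S_def N_def)
    from select_mat_mult_vec_eq_0_mono[OF I(1) I' Qx this]
    have "(select_mat m I * Q) *\<^sub>v x = 0\<^sub>v k" using SI Q x I(2) by simp
    then show "x = 0\<^sub>v k" using inj_matD[OF injSIQ SIQ x(1)] by simp
  qed
  then have PW: "pinv W * W = 1\<^sub>m k" using pinv_left_inverse[OF W] by simp
  have P: "pinv W \<in> carrier_mat k N" using pinv_carrier[OF W] .
  \<comment> \<open>\<open>W\<close> is a contraction and has a left inverse, whose norm is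
    therefore at least 1. This later absorbs additive constants into multiples of \<beta>.\<close>
  show "1 \<le> spec_norm (pinv (submatrix Q I' UNIV))"
  proof -
    let ?y = "unit_vec k 0 :: real vec"
    have y: "?y \<in> carrier_vec k" by simp
    have Wy: "W *\<^sub>v ?y \<in> carrier_vec N" using W by simp
    have "vec_norm2 (W *\<^sub>v ?y) \<le> vec_norm2 ?y"
      using select_mat_contraction[OF I', of "Q *\<^sub>v ?y"] orthonormal_columns_norm[OF Q orth y] S Q
      by (simp add: W_def S_def)
    moreover have "pinv W *\<^sub>v (W *\<^sub>v ?y) = ?y" using assoc_mult_mat_vec[OF P W y] PW by simp
    ultimately have "vec_norm2 ?y \<le> spec_norm (pinv W) * vec_norm2 ?y"
      using mult_mat_vec_spec_norm[OF P Wy]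
        mult_left_mono[of "vec_norm2 (W *\<^sub>v ?y)" "vec_norm2 ?y" "spec_norm (pinv W)"] by simp
    then show ?thesis using k by (simp add: sub_Q)
  qed
  show "\<exists>w \<in> carrier_vec (card I'). vec_norm2 w \<le> spec_norm (pinv (submatrix Q I' UNIV)) \<and>
      transpose_mat (submatrix A I' J) *\<^sub>v w = row (submatrix A UNIV J) i" if i: "i < m"
  proof (intro bexI conjI)
    define q where "q = row Q i"
    let ?w = "transpose_mat (pinv W) *\<^sub>v q"
    have q: "q \<in> carrier_vec k" using Q i by (simp add: q_def)
    show w: "?w \<in> carrier_vec (card I')" using P q by (simp add: N_def)
    have "vec_norm2 ?w \<le> spec_norm (pinv W) * vec_norm2 q"
      by (rule transpose_mult_mat_vec_spec_norm[OF P q])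
    also have "\<dots> \<le> spec_norm (pinv W)"
      using orthonormal_columns_row_le[OF Q orth i] by (simp add: q_def mult_left_le)
    finally show "vec_norm2 ?w \<le> spec_norm (pinv (submatrix Q I' UNIV))" by (simp add: sub_Q)
    have "S * C = W * M" unfolding M(2) W_def by (rule assoc_mult_mat[OF S Q M(1), symmetric])
    then have "transpose_mat (submatrix A I' J) = transpose_mat M * transpose_mat W"
      using transpose_mult[OF W M(1)] U_eq by simp
    then have "transpose_mat (submatrix A I' J) *\<^sub>v ?w = transpose_mat M *\<^sub>v (transpose_mat W *\<^sub>v ?w)"
      using M(1) W P q by simp
    also have "transpose_mat W *\<^sub>v ?w = (transpose_mat W * transpose_mat (pinv W)) *\<^sub>v q"
      using W P q by simp
    also have "transpose_mat W * transpose_mat (pinv W) = 1\<^sub>m k"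
      using transpose_mult[OF P W] PW by simp
    also have "transpose_mat M *\<^sub>v (1\<^sub>m k *\<^sub>v q) = transpose_mat M *\<^sub>v (transpose_mat Q *\<^sub>v unit_vec m i)"
      using q row_eq_transpose_mult[OF Q i] by (simp add: q_def)
    also have "\<dots> = transpose_mat C *\<^sub>v unit_vec m i"
      unfolding M(2) transpose_mult[OF Q M(1)] using M(1) Q by simp
    also have "\<dots> = row C i" using row_eq_transpose_mult[OF C i] by simp
    finally show "transpose_mat (submatrix A I' J) *\<^sub>v ?w = row (submatrix A UNIV J) i"
      by (simp add: C_def)
  qed
qed

section \<open>The error of a computed row\<close>

lemma vec_diff_telescope:
  fixes a b c d :: "real vec"
  assumes "a \<in> carrier_vec n" "b \<in> carrier_vec n" "c \<in> carrier_vec n" "d \<in> carrier_vec n"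
  shows "(a - b) + (b - c) - (d - c) = a - d"
  using assms by (intro eq_vecI) auto

lemma vec_diff_telescope':
  fixes a b c d :: "real vec"
  assumes "a \<in> carrier_vec n" "b \<in> carrier_vec n" "c \<in> carrier_vec n" "d \<in> carrier_vec n"
  shows "(a - c) - d - (b - (c + d)) = a - b"
  using assms by (intro eq_vecI) auto

lemma vec_add_diff_cancel:
  fixes a b c d :: "real vec"
  assumes "a \<in> carrier_vec n" "b \<in> carrier_vec n" "c \<in> carrier_vec n" "d \<in> carrier_vec n"
  shows "(a + c) - b - c - d = a - (b + d)"
  using assms by (intro eq_vecI) auto

text \<open>The analysis of one row without rounding in the final product. \<open>B\<close> stands
  for U^T and \<open>R\<close> for the transpose of the selected rows; both the target
  \<open>a\<close> and R x are recovered from k entries by the same \<open>L\<close>. So only the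
  residual w.r.t. \<open>B\<close> is amplified by \<nu>, while the interpolation error
  \<open>h\<close> enters once for \<open>a\<close> and once, times |s|, for R s.\<close>

lemma interpolated_row_error:
  fixes G B L R :: "real mat"
  assumes G: "G \<in> carrier_mat k N" and B: "B \<in> carrier_mat k N"
    and L: "L \<in> carrier_mat n k" and R: "R \<in> carrier_mat n N"
    and P\<rho>: "\<And>y. y \<in> carrier_vec k \<Longrightarrow> vec_norm2 (pinv G *\<^sub>v y) \<le> \<rho> * vec_norm2 y"
    and BG: "\<And>x. x \<in> carrier_vec N \<Longrightarrow> vec_norm2 (B *\<^sub>v x - G *\<^sub>v x) \<le> \<delta> * vec_norm2 x"
    and Lb: "\<And>y. y \<in> carrier_vec k \<Longrightarrow> vec_norm2 (L *\<^sub>v y) \<le> \<nu> * vec_norm2 y"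
    and RLB: "\<And>x. x \<in> carrier_vec N \<Longrightarrow> vec_norm2 (R *\<^sub>v x - L *\<^sub>v (B *\<^sub>v x)) \<le> h * vec_norm2 x"
    and a: "a \<in> carrier_vec n" and w: "w \<in> carrier_vec N" "vec_norm2 w \<le> \<beta>"
    and aLB: "vec_norm2 (a - L *\<^sub>v (B *\<^sub>v w)) \<le> h"
    and e: "e \<in> carrier_vec k" "vec_norm2 e \<le> \<eta>"
    and nonneg: "0 \<le> \<delta>" "0 \<le> \<rho>" "0 \<le> \<nu>" "0 \<le> h"
  defines "s \<equiv> pinv G *\<^sub>v (B *\<^sub>v w + e)" and "\<sigma> \<equiv> (1 + \<delta> * \<rho>) * \<beta> + \<rho> * \<eta>"
  shows "vec_norm2 s \<le> \<sigma>"
    and "vec_norm2 (a - R *\<^sub>v s) \<le> h * (1 + \<sigma>) + \<nu> * (\<delta> * (3 + \<delta> * \<rho>) * \<beta> + (1 + \<delta> * \<rho>) * \<eta>)"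
proof -
  have P: "pinv G \<in> carrier_mat N k" using pinv_carrier[OF G] .
  define c where "c = B *\<^sub>v w"
  have c: "c \<in> carrier_vec k" using B w by (simp add: c_def)
  have Pc: "pinv G *\<^sub>v c \<in> carrier_vec N" and Pe: "pinv G *\<^sub>v e \<in> carrier_vec N" using P c e by auto
  have s_eq: "s = pinv G *\<^sub>v c + pinv G *\<^sub>v e"
    unfolding s_def c_def[symmetric] by (rule mult_add_distrib_mat_vec[OF P c e(1)])
  have s: "s \<in> carrier_vec N" using Pc Pe by (simp add: s_eq)
  have "vec_norm2 (pinv G *\<^sub>v c) \<le> (1 + \<delta> * \<rho>) * vec_norm2 w" unfolding c_def by (rule perturbed_pinv_bounds(2)[OF G B P\<rho> BG nonneg(1,2) w(1)])
  also have "\<dots> \<le> (1 + \<delta> * \<rho>) * \<beta>" using w nonneg by (intro mult_left_mono) auto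
  finally have 1: "vec_norm2 (pinv G *\<^sub>v c) \<le> (1 + \<delta> * \<rho>) * \<beta>" .
  have 2: "vec_norm2 (pinv G *\<^sub>v e) \<le> \<rho> * \<eta>"
    using order.trans[OF P\<rho>[OF e(1)] mult_left_mono[OF e(2) nonneg(2)]] .
  show \<sigma>: "vec_norm2 s \<le> \<sigma>" unfolding s_eq \<sigma>_def by (rule vec_norm2_add_le[OF Pc Pe 1 2])
  have Bs: "B *\<^sub>v s \<in> carrier_vec k" using B s by simp
  have Rs: "R *\<^sub>v s \<in> carrier_vec n" using R s by simp
  have Lc: "L *\<^sub>v c \<in> carrier_vec n" and LBs: "L *\<^sub>v (B *\<^sub>v s) \<in> carrier_vec n" using L c Bs by auto
  have cBs: "c - B *\<^sub>v s \<in> carrier_vec k" using c Bs by simp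
  \<comment> \<open>The residual consists of the one for the exact right-hand side B w and the image
    of the data error \<open>e\<close>.\<close>
  have "c - B *\<^sub>v s = (c - B *\<^sub>v (pinv G *\<^sub>v c)) - B *\<^sub>v (pinv G *\<^sub>v e)"
    unfolding s_eq mult_add_distrib_mat_vec[OF B Pc Pe]
    using c mult_mat_vec_carrier[OF B Pc] mult_mat_vec_carrier[OF B Pe] by auto
  also have "vec_norm2 \<dots> \<le> \<delta> * (3 + \<delta> * \<rho>) * \<beta> + (1 + \<delta> * \<rho>) * \<eta>"
  proof (rule vec_norm2_diff_le[OF _ mult_mat_vec_carrier[OF B Pe]])
    show "c - B *\<^sub>v (pinv G *\<^sub>v c) \<in> carrier_vec k" using c B Pc by simp
    have "vec_norm2 (c - B *\<^sub>v (pinv G *\<^sub>v c)) \<le> \<delta> * (3 + \<delta> * \<rho>) * vec_norm2 w"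
      unfolding c_def by (rule perturbed_pinv_bounds(3)[OF G B P\<rho> BG nonneg(1,2) w(1)])
    also have "\<dots> \<le> \<delta> * (3 + \<delta> * \<rho>) * \<beta>" using w nonneg by (intro mult_left_mono) auto
    finally show "vec_norm2 (c - B *\<^sub>v (pinv G *\<^sub>v c)) \<le> \<delta> * (3 + \<delta> * \<rho>) * \<beta>" .
    have "vec_norm2 (B *\<^sub>v (pinv G *\<^sub>v e)) \<le> (1 + \<delta> * \<rho>) * vec_norm2 e" by (rule perturbed_pinv_bounds(1)[OF G B P\<rho> BG nonneg(1,2) e(1)])
    also have "\<dots> \<le> (1 + \<delta> * \<rho>) * \<eta>" using e nonneg by (intro mult_left_mono) auto
    finally show "vec_norm2 (B *\<^sub>v (pinv G *\<^sub>v e)) \<le> (1 + \<delta> * \<rho>) * \<eta>" .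
  qed
  finally have "vec_norm2 (L *\<^sub>v (c - B *\<^sub>v s)) \<le> \<nu> * (\<delta> * (3 + \<delta> * \<rho>) * \<beta> + (1 + \<delta> * \<rho>) * \<eta>)"
    using order.trans[OF Lb[OF cBs] mult_left_mono[OF _ nonneg(3)]] by blast
  moreover have "vec_norm2 (R *\<^sub>v s - L *\<^sub>v (B *\<^sub>v s)) \<le> h * \<sigma>"
    using order.trans[OF RLB[OF s] mult_left_mono[OF \<sigma> nonneg(4)]] .
  \<comment> \<open>The sum telescopes to a - R s: interpolation of \<open>a\<close>, residual of
    the solver, interpolation of R s.\<close>
  ultimately have "vec_norm2 ((a - L *\<^sub>v c) + L *\<^sub>v (c - B *\<^sub>v s) - (R *\<^sub>v s - L *\<^sub>v (B *\<^sub>v s)))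
      \<le> h + \<nu> * (\<delta> * (3 + \<delta> * \<rho>) * \<beta> + (1 + \<delta> * \<rho>) * \<eta>) + h * \<sigma>"
    using aLB[folded c_def] a Lc LBs Rs mult_mat_vec_carrier[OF L cBs]
    by (intro vec_norm2_diff_le[of _ n] vec_norm2_add_le[of _ n]) auto
  also have "(a - L *\<^sub>v c) + L *\<^sub>v (c - B *\<^sub>v s) - (R *\<^sub>v s - L *\<^sub>v (B *\<^sub>v s)) = a - R *\<^sub>v s"
    unfolding mult_minus_distrib_mat_vec[OF L c Bs]
    using a Lc LBs Rs by (rule vec_diff_telescope)
  finally show "vec_norm2 (a - R *\<^sub>v s)
      \<le> h * (1 + \<sigma>) + \<nu> * (\<delta> * (3 + \<delta> * \<rho>) * \<beta> + (1 + \<delta> * \<rho>) * \<eta>)"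
    by (simp add: algebra_simps)
qed

text \<open>The transposed row selection pads \<open>x\<close> with zeros. Thus R^T x and U^T x
  become A^T z and its entries at \<open>J\<close> for the same vector z, which is the form needed
  for interpolation.\<close>

lemma submatrix_transpose_mult_vec:
  assumes A: "A \<in> carrier_mat m n" and I: "I \<subseteq> {..<m}" and J: "J \<subseteq> {..<n}"
  shows "x \<in> carrier_vec (card I) \<Longrightarrow> transpose_mat (submatrix A I UNIV) *\<^sub>v x =
      transpose_mat A *\<^sub>v (transpose_mat (select_mat m I) *\<^sub>v x)"
    and "z \<in> carrier_vec m \<Longrightarrow> transpose_mat (submatrix A UNIV J) *\<^sub>v z =
      select_mat n J *\<^sub>v (transpose_mat A *\<^sub>v z)"
    and "x \<in> carrier_vec (card I) \<Longrightarrow> transpose_mat (submatrix A I J) *\<^sub>v x =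
      select_mat n J *\<^sub>v (transpose_mat A *\<^sub>v (transpose_mat (select_mat m I) *\<^sub>v x))"
proof -
  let ?S = "select_mat m I" and ?K = "select_mat n J"
  have S: "?S \<in> carrier_mat (card I) m" and K: "?K \<in> carrier_mat (card J) n"
    using select_mat_carrier[OF I] select_mat_carrier[OF J] by auto
  have KT: "transpose_mat ?K \<in> carrier_mat n (card J)" using K by simp
  show "transpose_mat (submatrix A I UNIV) *\<^sub>v x = transpose_mat A *\<^sub>v (transpose_mat ?S *\<^sub>v x)"
    if "x \<in> carrier_vec (card I)" for x
    using that A S unfolding submatrix_rows_eq_select_mat[OF A I] transpose_mult[OF S A] by simp
  show cols: "transpose_mat (submatrix A UNIV J) *\<^sub>v z = ?K *\<^sub>v (transpose_mat A *\<^sub>v z)"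
    if "z \<in> carrier_vec m" for z
    using that A K unfolding submatrix_cols_eq_select_mat[OF A J] transpose_mult[OF A KT] by simp
  show "transpose_mat (submatrix A I J) *\<^sub>v x = ?K *\<^sub>v (transpose_mat A *\<^sub>v (transpose_mat ?S *\<^sub>v x))"
    if x: "x \<in> carrier_vec (card I)" for x
  proof -
    have AK: "A * transpose_mat ?K \<in> carrier_mat m (card J)" using A KT by simp
    have Sx: "transpose_mat ?S *\<^sub>v x \<in> carrier_vec m" using S x by simp
    have "transpose_mat (submatrix A I J) = transpose_mat (submatrix A UNIV J) * transpose_mat ?S"
      unfolding submatrix_eq_select_mat[OF A I J] submatrix_cols_eq_select_mat[OF A J]
      by (rule transpose_mult[OF S AK])
    moreover have "transpose_mat (submatrix A UNIV J) \<in> carrier_mat (card J) m"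
      unfolding submatrix_cols_eq_select_mat[OF A J] using AK by simp
    ultimately have "transpose_mat (submatrix A I J) *\<^sub>v x = transpose_mat (submatrix A UNIV J) *\<^sub>v (transpose_mat ?S *\<^sub>v x)"
      using assoc_mult_mat_vec[of "transpose_mat (submatrix A UNIV J)" "card J" m "transpose_mat ?S"] S x by simp
    then show ?thesis unfolding cols[OF Sx] .
  qed
qed

lemma submatrix_carrier:
  fixes A :: "real mat"
  assumes A: "A \<in> carrier_mat m n"
  shows "I \<subseteq> {..<m} \<Longrightarrow> submatrix A I UNIV \<in> carrier_mat (card I) n"
    and "J \<subseteq> {..<n} \<Longrightarrow> submatrix A UNIV J \<in> carrier_mat m (card J)"
    and "I \<subseteq> {..<m} \<Longrightarrow> J \<subseteq> {..<n} \<Longrightarrow> submatrix A I J \<in> carrier_mat (card I) (card J)"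
  using A submatrix_rows_eq_select_mat[OF A, of I] submatrix_cols_eq_select_mat[OF A, of J]
    submatrix_eq_select_mat[OF A, of I J] select_mat_carrier[of I m] select_mat_carrier[of J n]
  by auto

text \<open>\<open>interpolated_row_error\<close> is applied to the matrix \<open>G\<close> that the
  solver effectively inverts. The errors of \<open>R'\<close> and of the final product act
  afterwards on a vector \<open>s\<close> with |s| \<le> 3 \<beta>, and so carry no factor
  \<nu>.\<close>

lemma fl_cur_row_error:
  assumes A: "A \<in> carrier_mat m n" and J: "J \<subseteq> {..<n}" "card J = k" and k: "0 < k"
    and I: "I \<subseteq> I'" "card I = k" and I': "I' \<subseteq> {..<m}"
    and inv: "invertible_mat (submatrix A I J)"
    and X: "X \<in> carrier_mat k n" and rank: "mat_rank (submatrix X UNIV J) = k"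
    and QC: "QC \<in> carrier_mat m k" "orthonormal_columns QC" "column_space QC = column_space (submatrix A UNIV J)"
    and QX: "QX \<in> carrier_mat n k" "orthonormal_columns QX" "column_space QX = column_space (transpose_mat X)"
    and u: "0 \<le> u" "real (card I') * u \<le> 1" and eps: "0 < \<epsilon>" "\<epsilon> \<le> spec_norm A"
    and g: "0 \<le> g" "100 * (g * spec_norm A) \<le> \<epsilon>"
    and fl: "is_fl_cur u g \<epsilon> A I' J F" and i: "i < m"
  defines "\<beta> \<equiv> spec_norm (pinv (submatrix QC I' UNIV))" and "\<nu> \<equiv> spec_norm (pinv (submatrix QX J UNIV))"
    and "\<tau> \<equiv> frob_norm (A * (1\<^sub>m n - pinv X * X))"
  shows "vec_norm2 (row A i - row F i) \<le>
    4 * \<beta> * \<nu> * (\<tau> + 2 * \<epsilon>) + 3 * \<beta> * spec_norm A * (g + 4 * real n * real (card I') * u)"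
proof -
  define N where "N = card I'"
  define a where "a = spec_norm A"
  \<comment> \<open>The common absolute error of the three computed factors; the assumption on
    \<open>g\<close> says t \<le> \<epsilon> / 100.\<close>
  define t where "t = g * a"
  define C where "C = submatrix A UNIV J"
  define U where "U = submatrix A I' J"
  define R where "R = submatrix A I' UNIV"
  define B where "B = transpose_mat U"
  define K where "K = select_mat n J"
  define S where "S = select_mat m I'"
  have C: "C \<in> carrier_mat m k" and U: "U \<in> carrier_mat N k" and R: "R \<in> carrier_mat N n"
    using submatrix_carrier[OF A] J I' by (auto simp: C_def U_def R_def N_def)
  have B: "B \<in> carrier_mat k N" using U by (simp add: B_def)
  have RT: "transpose_mat R \<in> carrier_mat n N" using R by simp
  have K: "K \<in> carrier_mat k n" and S: "S \<in> carrier_mat N m"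
    using select_mat_carrier[OF J(1)] select_mat_carrier[OF I'] J(2) by (auto simp: K_def S_def N_def)
  have a_pos: "0 < a" and g1: "g \<le> 1" and t: "0 \<le> t" "100 * t \<le> \<epsilon>"
  proof -
    show "0 < a" using eps by (simp add: a_def)
    moreover have "0 \<le> g * a" using g eps by (simp add: a_def)
    then have "g * a \<le> 1 * a" using g(2) eps unfolding a_def by linarith
    ultimately show "g \<le> 1" by (simp add: mult_le_cancel_right)
    show "0 \<le> t" "100 * t \<le> \<epsilon>" using g by (simp_all add: t_def a_def)
  qed
  obtain C' U' R' s where C': "computed_with_error t C C'" and U': "computed_with_error t U U'"
    and R': "computed_with_error t R R'"
    and solve: "backward_stable_min_norm_solution g \<epsilon> (transpose_mat U') (row C' i) s"
    and mult: "fl_mult_mat_vec u (transpose_mat R') s (row F i)" and F: "F \<in> carrier_mat m n"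
    using fl A i unfolding is_fl_cur_def t_def a_def C_def U_def R_def by blast
  obtain EC where EC: "EC \<in> carrier_mat m k" "spec_norm EC \<le> t" "C' = C + EC"
    using C' C unfolding computed_with_error_def by auto
  obtain EU where EU: "EU \<in> carrier_mat N k" "spec_norm EU \<le> t" "U' = U + EU"
    using U' U unfolding computed_with_error_def by auto
  obtain ER where ER: "ER \<in> carrier_mat N n" "spec_norm ER \<le> t" "R' = R + ER"
    using R' R unfolding computed_with_error_def by auto
  define B' where "B' = transpose_mat U'"
  have B': "B' \<in> carrier_mat k N" and B'_eq: "B' = B + transpose_mat EU"
    using U EU transpose_add[OF U EU(1)] by (auto simp: B'_def B_def)
  obtain Z E1 E2 where Z: "is_sv_truncation \<epsilon> B' Z" and E1: "E1 \<in> carrier_mat k N" "spec_norm E1 \<le> g * spec_norm Z"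
    and E2: "E2 \<in> carrier_vec k" "vec_norm2 E2 \<le> g * vec_norm2 (row C' i)"
    and rank_eq: "mat_rank (Z + E1) = mat_rank Z" and s_eq: "s = pinv (Z + E1) *\<^sub>v (row C' i + E2)"
    using solve B' unfolding backward_stable_min_norm_solution_def B'_def[symmetric] by auto
  obtain Y where Zc: "Z \<in> carrier_mat k N" and Y: "Y \<in> carrier_mat N k"
    and ZYZ: "\<And>x. x \<in> carrier_vec N \<Longrightarrow> Z *\<^sub>v (Y *\<^sub>v (Z *\<^sub>v x)) = Z *\<^sub>v x"
    and Yb: "\<And>y. y \<in> carrier_vec k \<Longrightarrow> \<epsilon> * vec_norm2 (Y *\<^sub>v y) \<le> vec_norm2 y"
    and BZ: "\<And>x. x \<in> carrier_vec N \<Longrightarrow> vec_norm2 (B' *\<^sub>v x - Z *\<^sub>v x) \<le> \<epsilon> * vec_norm2 x"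
    using sv_truncation_properties[OF B' Z eps(1)] by blast
  note mc = mult_mat_vec_carrier
  have Az: "vec_norm2 (transpose_mat A *\<^sub>v z) \<le> a * vec_norm2 z" if "z \<in> carrier_vec m" for z
    using transpose_mult_mat_vec_spec_norm[OF A that] by (simp add: a_def)
  have Kb: "vec_norm2 (K *\<^sub>v x) \<le> vec_norm2 x" if "x \<in> carrier_vec n" for x
    using select_mat_contraction[OF J(1) that] by (simp add: K_def)
  have Sb: "vec_norm2 (transpose_mat S *\<^sub>v x) \<le> vec_norm2 x" and Sx: "transpose_mat S *\<^sub>v x \<in> carrier_vec m"
    and Rx: "transpose_mat R *\<^sub>v x = transpose_mat A *\<^sub>v (transpose_mat S *\<^sub>v x)"
    and Bx: "B *\<^sub>v x = K *\<^sub>v (transpose_mat A *\<^sub>v (transpose_mat S *\<^sub>v x))"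
    if x: "x \<in> carrier_vec N" for x
    using select_mat_transpose_contraction[OF I'] submatrix_transpose_mult_vec(1,3)[OF A I' J(1)] x S
    by (auto simp: S_def N_def R_def B_def U_def K_def)
  have Rb: "vec_norm2 (transpose_mat R *\<^sub>v x) \<le> a * vec_norm2 x"
    and Bb: "vec_norm2 (B *\<^sub>v x) \<le> a * vec_norm2 x" if x: "x \<in> carrier_vec N" for x
  proof -
    show R: "vec_norm2 (transpose_mat R *\<^sub>v x) \<le> a * vec_norm2 x"
      unfolding Rx[OF x]
      using order.trans[OF Az[OF Sx[OF x]] mult_left_mono[OF Sb[OF x]]] a_pos by simp
    have "transpose_mat A *\<^sub>v (transpose_mat S *\<^sub>v x) \<in> carrier_vec n" using A Sx[OF x] by simp
    from order.trans[OF Kb[OF this] R[unfolded Rx[OF x]]]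
    show "vec_norm2 (B *\<^sub>v x) \<le> a * vec_norm2 x" unfolding Bx[OF x] .
  qed
  have EUb: "vec_norm2 (transpose_mat EU *\<^sub>v x) \<le> t * vec_norm2 x" if "x \<in> carrier_vec N" for x
    using transpose_mult_mat_vec_spec_norm[OF EU(1) that] mult_right_mono[OF EU(2) vec_norm2_nonneg[of x]] by linarith
  have ERb: "vec_norm2 (transpose_mat ER *\<^sub>v x) \<le> t * vec_norm2 x" if "x \<in> carrier_vec N" for x
    using transpose_mult_mat_vec_spec_norm[OF ER(1) that] mult_right_mono[OF ER(2) vec_norm2_nonneg[of x]] by linarith
  have EUT: "transpose_mat EU \<in> carrier_mat k N" and ERT: "transpose_mat ER \<in> carrier_mat n N"
    using EU ER by auto
  have B'x: "B' *\<^sub>v x = B *\<^sub>v x + transpose_mat EU *\<^sub>v x" if "x \<in> carrier_vec N" for x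
    unfolding B'_eq by (rule add_mult_distrib_mat_vec[OF B EUT that])
  \<comment> \<open>The three shares are \<open>U\<close>, its error t \<le> a, and the truncation
    \<epsilon> \<le> a. The relative backward error of the solver thus becomes an absolute one of at
    most 3 t.\<close>
  have "spec_norm Z \<le> 3 * a"
  proof (rule spec_norm_le[OF Zc])
    fix x :: "real vec" assume x: "x \<in> carrier_vec N"
    have "vec_norm2 (B' *\<^sub>v x) \<le> a * vec_norm2 x + t * vec_norm2 x"
      unfolding B'x[OF x] by (rule vec_norm2_add_le[OF mc[OF B x] mc[OF EUT x] Bb[OF x] EUb[OF x]])
    then have "vec_norm2 (B' *\<^sub>v x - (B' *\<^sub>v x - Z *\<^sub>v x)) \<le> (a * vec_norm2 x + t * vec_norm2 x) + \<epsilon> * vec_norm2 x"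
      using mc[OF B' x] mc[OF Zc x] BZ[OF x] by (intro vec_norm2_diff_le[of _ k]) auto
    also have "B' *\<^sub>v x - (B' *\<^sub>v x - Z *\<^sub>v x) = Z *\<^sub>v x"
      using mc[OF B' x] mc[OF Zc x] by auto
    also have "(a * vec_norm2 x + t * vec_norm2 x) + \<epsilon> * vec_norm2 x = (a + t + \<epsilon>) * vec_norm2 x"
      by (simp add: algebra_simps)
    also have "\<dots> \<le> (3 * a) * vec_norm2 x"
      using t eps by (intro mult_right_mono) (auto simp: a_def)
    finally show "vec_norm2 (Z *\<^sub>v x) \<le> 3 * a * vec_norm2 x" .
  qed (use a_pos in simp)
  then have "g * spec_norm Z \<le> g * (3 * a)" using g(1) by (rule mult_left_mono)
  then have E1_le: "spec_norm E1 \<le> 3 * t" using E1(2) by (simp add: t_def)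
  have E1b: "vec_norm2 (E1 *\<^sub>v x) \<le> (3 * t) * vec_norm2 x" if "x \<in> carrier_vec N" for x
    using mult_mat_vec_spec_norm[OF E1(1) that] mult_right_mono[OF E1_le vec_norm2_nonneg[of x]] by linarith
  define G where "G = Z + E1"
  have G: "G \<in> carrier_mat k N" using Zc E1 by (simp add: G_def)
  \<comment> \<open>3 t is the solver perturbation, subtracted from the smallest kept singular
    value. In \<delta> the truncation, the error of \<open>U'\<close> and the solver perturbation
    add up to \<epsilon> + t + 3 t.\<close>
  define \<rho> where "\<rho> = 1 / (\<epsilon> - 3 * t)"
  define \<delta> where "\<delta> = \<epsilon> + 4 * t"
  have P\<rho>: "vec_norm2 (pinv G *\<^sub>v y) \<le> \<rho> * vec_norm2 y" if "y \<in> carrier_vec k" for y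
    using pinv_perturbation_bound[OF Zc E1(1) Y ZYZ Yb E1b _ rank_eq that] t eps(1)
    by (simp add: G_def \<rho>_def)
  have BG: "vec_norm2 (B *\<^sub>v x - G *\<^sub>v x) \<le> \<delta> * vec_norm2 x" if x: "x \<in> carrier_vec N" for x
  proof -
    have Gx: "G *\<^sub>v x = Z *\<^sub>v x + E1 *\<^sub>v x" unfolding G_def by (rule add_mult_distrib_mat_vec[OF Zc E1(1) x])
    have "vec_norm2 ((B' *\<^sub>v x - Z *\<^sub>v x) - transpose_mat EU *\<^sub>v x - E1 *\<^sub>v x)
        \<le> (\<epsilon> * vec_norm2 x + t * vec_norm2 x) + 3 * t * vec_norm2 x"
      using BZ[OF x] EUb[OF x] E1b[OF x] mc[OF B' x] mc[OF Zc x] mc[OF EUT x] mc[OF E1(1) x]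
      by (intro vec_norm2_diff_le[of _ k]) auto
    also have "(B' *\<^sub>v x - Z *\<^sub>v x) - transpose_mat EU *\<^sub>v x - E1 *\<^sub>v x = B *\<^sub>v x - G *\<^sub>v x"
      unfolding B'x[OF x] Gx using mc[OF B x] mc[OF Zc x] mc[OF EUT x] mc[OF E1(1) x]
      by (rule vec_add_diff_cancel)
    finally show ?thesis by (simp add: \<delta>_def algebra_simps)
  qed
  obtain L where L: "L \<in> carrier_mat n k"
    and Lb: "\<And>y. y \<in> carrier_vec k \<Longrightarrow> vec_norm2 (L *\<^sub>v y) \<le> \<nu> * vec_norm2 y"
    and AL: "\<And>z. z \<in> carrier_vec m \<Longrightarrow>
      vec_norm2 (transpose_mat A *\<^sub>v z - L *\<^sub>v (K *\<^sub>v (transpose_mat A *\<^sub>v z))) \<le> \<nu> * \<tau> * vec_norm2 z"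
    using row_space_interpolation[OF A J k X rank QX] unfolding \<nu>_def \<tau>_def K_def by blast
  have \<beta>: "1 \<le> \<beta>"
    using column_space_coefficients(1)[OF A J k I I' inv QC] by (simp add: \<beta>_def)
  obtain w where w: "w \<in> carrier_vec N" "vec_norm2 w \<le> \<beta>" "B *\<^sub>v w = row C i"
    using column_space_coefficients(2)[OF A J k I I' inv QC i] by (auto simp: \<beta>_def N_def B_def U_def C_def)
  have \<nu>: "0 \<le> \<nu>" and \<tau>: "0 \<le> \<tau>" by (simp_all add: \<nu>_def \<tau>_def)
  have row_A: "row A i = transpose_mat A *\<^sub>v unit_vec m i" by (rule row_eq_transpose_mult[OF A i])
  have row_C: "row C i = K *\<^sub>v row A i"
    using submatrix_transpose_mult_vec(2)[OF A I' J(1), of "unit_vec m i"] row_eq_transpose_mult[OF C i] i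
    by (simp add: row_A C_def K_def)
  have Ai: "row A i \<in> carrier_vec n" and Fi: "row F i \<in> carrier_vec n" and Ci: "row C i \<in> carrier_vec k"
    and ECi: "row EC i \<in> carrier_vec k" using A F C EC i by auto
  have Ci_le: "vec_norm2 (row C i) \<le> a"
    using order.trans[OF Kb[OF Ai]] Az[of "unit_vec m i"] row_A row_C i by simp
  have ECi_le: "vec_norm2 (row EC i) \<le> t"
    using transpose_mult_mat_vec_spec_norm[OF EC(1), of "unit_vec m i"] row_eq_transpose_mult[OF EC(1) i] EC(2) i
    by simp
  have row_C': "row C' i = row C i + row EC i" using EC(1,3) C i by auto
  \<comment> \<open>The total error in the right-hand side: t from the computed \<open>C\<close>,
    and 2 t from the solver since |C'_i| \<le> 2 a.\<close>
  define e where "e = row EC i + E2"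
  have "vec_norm2 (row C' i) \<le> a + t"
    unfolding row_C' by (rule vec_norm2_add_le[OF Ci ECi Ci_le ECi_le])
  then have "g * vec_norm2 (row C' i) \<le> g * (a + a)"
    using t eps a_def g(1) by (intro mult_left_mono) auto
  then have E2_le: "vec_norm2 E2 \<le> 2 * t" using E2(2) by (simp add: t_def)
  have e: "e \<in> carrier_vec k" "vec_norm2 e \<le> t + 2 * t"
    unfolding e_def by (rule add_carrier_vec[OF ECi E2(1)], rule vec_norm2_add_le[OF ECi E2(1) ECi_le E2_le])
  have s: "s = pinv G *\<^sub>v (B *\<^sub>v w + e)"
    unfolding s_eq G_def e_def w(3) row_C' using assoc_add_vec[OF Ci ECi E2(1)] by simp
  have nonneg: "0 \<le> \<delta>" "0 \<le> \<rho>" "0 \<le> \<nu> * \<tau>"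
    using t eps \<nu> \<tau> by (simp_all add: \<delta>_def \<rho>_def)
  have RLB: "vec_norm2 (transpose_mat R *\<^sub>v x - L *\<^sub>v (B *\<^sub>v x)) \<le> \<nu> * \<tau> * vec_norm2 x"
    if x: "x \<in> carrier_vec N" for x
    unfolding Rx[OF x] Bx[OF x]
    using order.trans[OF AL[OF Sx[OF x]] mult_left_mono[OF Sb[OF x] nonneg(3)]] .
  have aLB: "vec_norm2 (row A i - L *\<^sub>v (B *\<^sub>v w)) \<le> \<nu> * \<tau>"
    using AL[of "unit_vec m i"] i by (simp add: w(3) row_C row_A)
  define \<sigma> where "\<sigma> = (1 + \<delta> * \<rho>) * \<beta> + \<rho> * (t + 2 * t)"
  have s_le: "vec_norm2 s \<le> \<sigma>" and row_le: "vec_norm2 (row A i - transpose_mat R *\<^sub>v s)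
      \<le> \<nu> * \<tau> * (1 + \<sigma>) + \<nu> * (\<delta> * (3 + \<delta> * \<rho>) * \<beta> + (1 + \<delta> * \<rho>) * (t + 2 * t))"
    unfolding \<sigma>_def s
    by (rule interpolated_row_error[OF G B L RT P\<rho> BG Lb RLB Ai w(1,2) aLB e nonneg(1,2) \<nu> nonneg(3)]; assumption)+
  \<comment> \<open>The extreme case is t = \<epsilon> / 100, with values 104/97 and 3/97.\<close>
  have \<delta>\<rho>: "\<delta> * \<rho> \<le> 27/25" and \<rho>t: "\<rho> * (t + 2 * t) \<le> 1/25"
    using t eps(1) by (simp_all add: \<delta>_def \<rho>_def divide_simps)
  have \<sigma>_le: "\<sigma> \<le> 11/5 * \<beta>"
  proof -
    have "(1 + \<delta> * \<rho>) * \<beta> \<le> 52/25 * \<beta>" using \<delta>\<rho> \<beta> by (intro mult_right_mono) auto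
    then show ?thesis using \<rho>t \<beta> unfolding \<sigma>_def by linarith
  qed
  have \<sigma>_nonneg: "0 \<le> \<sigma>" using s_le vec_norm2_nonneg[of s] by linarith
  have main: "vec_norm2 (row A i - transpose_mat R *\<^sub>v s) \<le> 4 * \<beta> * \<nu> * (\<tau> + 2 * \<epsilon>)"
  proof -
    have "\<nu> * \<tau> * (1 + \<sigma>) \<le> \<nu> * \<tau> * (4 * \<beta>)" using \<sigma>_le \<beta> nonneg by (intro mult_left_mono) auto
    \<comment> \<open>Here 8 \<epsilon> \<beta> is 4 \<beta> times the 2 \<epsilon> of the claim.
      The left side is below 4.4 \<epsilon> \<beta>, so the data errors fit in as well; \<beta>
      \<ge> 1 absorbs those without a factor \<beta>.\<close>
    moreover have "\<delta> * (3 + \<delta> * \<rho>) * \<beta> + (1 + \<delta> * \<rho>) * (t + 2 * t) \<le> 8 * \<epsilon> * \<beta>"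
    proof -
      have "\<delta> * (3 + \<delta> * \<rho>) \<le> (26/25 * \<epsilon>) * (102/25)"
        using \<delta>\<rho> t nonneg eps by (intro mult_mono) (auto simp: \<delta>_def)
      then have "\<delta> * (3 + \<delta> * \<rho>) * \<beta> \<le> (26/25 * \<epsilon>) * (102/25) * \<beta>" using \<beta> by (intro mult_right_mono) auto
      moreover have "(1 + \<delta> * \<rho>) * (t + 2 * t) \<le> 52/25 * (3/100 * \<epsilon>)"
        using \<delta>\<rho> t nonneg by (intro mult_mono) auto
      moreover have "\<epsilon> * 1 \<le> \<epsilon> * \<beta>" using \<beta> eps by (intro mult_left_mono) auto
      ultimately show ?thesis using eps(1) by linarith
    qed
    then have "\<nu> * (\<delta> * (3 + \<delta> * \<rho>) * \<beta> + (1 + \<delta> * \<rho>) * (t + 2 * t)) \<le> \<nu> * (8 * \<epsilon> * \<beta>)"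
      using \<nu> by (intro mult_left_mono)
    ultimately show ?thesis using row_le by (simp add: algebra_simps)
  qed
  have sc: "s \<in> carrier_vec N"
    unfolding s using mc[OF pinv_carrier[OF G], of "B *\<^sub>v w + e"] mc[OF B w(1)] e by simp
  have R'T: "transpose_mat R' \<in> carrier_mat n N" using R ER by simp
  have R's: "transpose_mat R' *\<^sub>v x = transpose_mat R *\<^sub>v x + transpose_mat ER *\<^sub>v x" if "x \<in> carrier_vec N" for x
    unfolding ER(3) transpose_add[OF R ER(1)] by (rule add_mult_distrib_mat_vec[OF RT ERT that])
  \<comment> \<open>A row r is tested against the matrix itself: |r|^2 is entry \<open>j\<close> of
    R'^T r, hence at most (a + t) |r|.\<close>
  have R'_rows: "vec_norm2 (row (transpose_mat R') j) \<le> 2 * a" if j: "j < n" for j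
  proof (rule power2_le_imp_le)
    let ?r = "row (transpose_mat R') j"
    have r: "?r \<in> carrier_vec N" using R'T j by auto
    have "(vec_norm2 ?r)\<^sup>2 = (transpose_mat R' *\<^sub>v ?r) $ j"
      unfolding vec_norm2_sq using R'T j by simp
    also have "\<dots> \<le> vec_norm2 (transpose_mat R' *\<^sub>v ?r)"
      using index_le_vec_norm2[of j "transpose_mat R' *\<^sub>v ?r"] R'T j by simp
    also have "\<dots> \<le> a * vec_norm2 ?r + t * vec_norm2 ?r"
      unfolding R's[OF r] by (rule vec_norm2_add_le[OF mc[OF RT r] mc[OF ERT r] Rb[OF r] ERb[OF r]])
    also have "\<dots> \<le> 2 * a * vec_norm2 ?r"
      using t eps mult_right_mono[of t a "vec_norm2 ?r"] by (simp add: a_def)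
    finally have "vec_norm2 ?r * vec_norm2 ?r \<le> 2 * a * vec_norm2 ?r" by (simp add: power2_eq_square)
    then have "vec_norm2 ?r \<le> 2 * a"
      using vec_norm2_nonneg[of ?r] a_pos by (cases "vec_norm2 ?r = 0") (simp_all add: mult_le_cancel_right)
    then show "(vec_norm2 ?r)\<^sup>2 \<le> (2 * a)\<^sup>2" by (intro power_mono) auto
  qed (use a_pos in simp)
  have "vec_norm2 (row F i - transpose_mat R' *\<^sub>v s) \<le> 2 * real n * real N * u * (2 * a * vec_norm2 s)"
    using fl_mult_mat_vec_error(2)[OF mult R'T sc u(1) u(2)[folded N_def] R'_rows] .
  also have "\<dots> \<le> 2 * real n * real N * u * (2 * a * \<sigma>)"
    using s_le u(1) a_pos by (intro mult_left_mono) auto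
  \<comment> \<open>Three sources are separated: the row computed exactly from \<open>s\<close>, the
    error in \<open>R'\<close>, and the rounding of the product.\<close>
  finally have "vec_norm2 ((row A i - transpose_mat R *\<^sub>v s) - transpose_mat ER *\<^sub>v s - (row F i - transpose_mat R' *\<^sub>v s))
      \<le> (4 * \<beta> * \<nu> * (\<tau> + 2 * \<epsilon>) + t * \<sigma>) + 2 * real n * real N * u * (2 * a * \<sigma>)"
    using main order.trans[OF ERb[OF sc] mult_left_mono[OF s_le t(1)]] Ai Fi mc[OF RT sc] mc[OF R'T sc] mc[OF ERT sc]
    by (intro vec_norm2_diff_le[of _ n]) auto
  also have "(row A i - transpose_mat R *\<^sub>v s) - transpose_mat ER *\<^sub>v s - (row F i - transpose_mat R' *\<^sub>v s) = row A i - row F i"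
    unfolding R's[OF sc] using Ai Fi mc[OF RT sc] mc[OF ERT sc] by (rule vec_diff_telescope')
  also have "(4 * \<beta> * \<nu> * (\<tau> + 2 * \<epsilon>) + t * \<sigma>) + 2 * real n * real N * u * (2 * a * \<sigma>)
      = 4 * \<beta> * \<nu> * (\<tau> + 2 * \<epsilon>) + \<sigma> * (a * (g + 4 * real n * real N * u))"
    by (simp add: t_def algebra_simps)
  also have "\<dots> \<le> 4 * \<beta> * \<nu> * (\<tau> + 2 * \<epsilon>) + (3 * \<beta>) * (a * (g + 4 * real n * real N * u))"
    using \<sigma>_le \<beta> a_pos g(1) u(1) by (intro add_left_mono mult_right_mono) auto
  finally show ?thesis by (simp add: a_def N_def mult.assoc)
qed

text \<open>Source of the factor sqrt m in the theorem: the errors are controlled row by row, since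
  the perturbations of the solver differ between rows.\<close>

lemma frob_norm_le_rows:
  assumes M: "M \<in> carrier_mat m n" and c: "0 \<le> c" and rows: "\<And>i. i < m \<Longrightarrow> vec_norm2 (row M i) \<le> c"
  shows "frob_norm M \<le> sqrt (real m) * c"
proof -
  have "(\<Sum>i<m. (vec_norm2 (row M i))\<^sup>2) \<le> (\<Sum>i<m. c\<^sup>2)"
    using rows by (intro sum_mono power_mono) auto
  then have "frob_norm M \<le> sqrt (real m * c\<^sup>2)"
    using M unfolding frob_norm_rows by (intro real_sqrt_le_mono) simp
  also have "\<dots> = sqrt (real m) * c" using c by (simp add: real_sqrt_mult)
  finally show ?thesis .
qed

section \<open>Polynomials for the gamma factors\<close>

lemma poly3_simps [simp]:
  "poly3 (p + q) x y z = poly3 p x y z + poly3 q x y z"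
  "poly3 (p * q) x y z = poly3 p x y z * poly3 q x y z"
  by (simp_all add: poly3_def)

definition const3 :: "real \<Rightarrow> real poly poly poly" where
  "const3 c = [:[:[:c:]:]:]"

text \<open>The nesting level decides the variable: \<open>poly3\<close> substitutes m at the
  outermost level and k at the innermost.\<close>

definition var_m :: "real poly poly poly" where "var_m = [:0, 1:]"
definition var_n :: "real poly poly poly" where "var_n = [:[:0, 1:]:]"
definition var_k :: "real poly poly poly" where "var_k = [:[:[:0, 1:]:]:]"

lemma poly3_atoms [simp]:
  "poly3 (const3 c) x y z = c" "poly3 var_m x y z = x" "poly3 var_n x y z = y" "poly3 var_k x y z = z"
  by (simp_all add: poly3_def const3_def var_m_def var_n_def var_k_def)

text \<open>Each role of gamma has its own polynomial: \<open>p\<close> for the extraction and the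
  solver is given, \<open>q\<close> in the condition on \<epsilon> and \<open>r\<close> in the bound
  are found. Both are fixed before dimensions and data, and depend only on \<open>p\<close> and
  \<kappa>.\<close>

theorem theorem3p9:
  fixes \<kappa> :: real and p :: "real poly poly poly"
  assumes "0 \<le> \<kappa>"
  shows "\<exists>q r :: real poly poly poly.
    \<forall>(m::nat) (n::nat) (k::nat) (A :: real mat) (I :: nat set) (J :: nat set) (I0 :: nat set)
      (X :: real mat) (QC :: real mat) (QX :: real mat) (\<epsilon>::real) (u::real) (F :: real mat).
      A \<in> carrier_mat m n \<and>
      I \<subseteq> {..<m} \<and> J \<subseteq> {..<n} \<and> card I = k \<and> card J = k \<and> 0 < k \<and> k \<le> mat_rank A \<and>
      I0 \<subseteq> {..<m} \<and> I0 \<inter> I = {} \<and> real (card I0) \<le> \<kappa> * real k \<and>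
      invertible_mat (submatrix A I J) \<and>
      X \<in> carrier_mat k n \<and> mat_rank (submatrix X UNIV J) = k \<and>
      QC \<in> carrier_mat m k \<and> orthonormal_columns QC \<and>
      column_space QC = column_space (submatrix A UNIV J) \<and>
      QX \<in> carrier_mat n k \<and> orthonormal_columns QX \<and>
      column_space QX = column_space (transpose_mat X) \<and>
      0 < u \<and> u < 1 \<and> 0 < \<epsilon> \<and> \<epsilon> < 1 \<and> \<epsilon> < spec_norm A \<and>
      gamma_factor q m n k u * spec_norm A < \<epsilon> \<and>
      is_fl_cur u (gamma_factor p m n k u) \<epsilon> A (I \<union> I0) J F
      \<longrightarrow>
      frob_norm (A - F)
        \<le> 4 * sqrt (real m) * spec_norm (pinv (submatrix QC (I \<union> I0) UNIV))
            * spec_norm (pinv (submatrix QX J UNIV))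
            * (frob_norm (A * (1\<^sub>m n - pinv X * X)) + 2 * \<epsilon>)
          + gamma_factor r m n k u * spec_norm A
            * spec_norm (pinv (submatrix QC (I \<union> I0) UNIV))"
proof -
  \<comment> \<open>The smallness condition on \<open>q\<close> serves to get \<open>100 g \<parallel>A\<parallel> \<le> \<epsilon>\<close> and \<open>card (I \<union> I0) u \<le> 1\<close>.\<close>
  define q where "q = const3 100 * p + const3 (1 + \<kappa>) * var_k"
  \<comment> \<open>The row bound contributes 3 g and 12 n N u with N \<le> (1 + \<kappa>) k; the
    factor \<open>var_m\<close> replaces sqrt m, which is not a polynomial.\<close>
  define r where "r = var_m * (const3 3 * p + const3 (12 * (1 + \<kappa>)) * (var_k * var_n))"
  show ?thesis
  proof (rule exI[of _ q], rule exI[of _ r], intro allI impI, elim conjE)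
    fix m n k A I J I0 X QC QX and \<epsilon> u :: real and F
    assume A: "A \<in> carrier_mat m n" and I: "I \<subseteq> {..<m}" "card I = k"
      and J: "J \<subseteq> {..<n}" "card J = k" and k: "0 < k"
      and I0: "I0 \<subseteq> {..<m}" "I0 \<inter> I = {}" "real (card I0) \<le> \<kappa> * real k"
      and inv: "invertible_mat (submatrix A I J)"
      and X: "X \<in> carrier_mat k n" and rank: "mat_rank (submatrix X UNIV J) = k"
      and QC: "QC \<in> carrier_mat m k" "orthonormal_columns QC"
        "column_space QC = column_space (submatrix A UNIV J)"
      and QX: "QX \<in> carrier_mat n k" "orthonormal_columns QX"
        "column_space QX = column_space (transpose_mat X)"
      and u: "0 < u" and eps: "0 < \<epsilon>" "\<epsilon> < spec_norm A"
      and small: "gamma_factor q m n k u * spec_norm A < \<epsilon>"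
      and fl: "is_fl_cur u (gamma_factor p m n k u) \<epsilon> A (I \<union> I0) J F"
    define a where "a = spec_norm A"
    define g where "g = gamma_factor p m n k u"
    define N where "N = card (I \<union> I0)"
    define \<beta> where "\<beta> = spec_norm (pinv (submatrix QC (I \<union> I0) UNIV))"
    define \<nu> where "\<nu> = spec_norm (pinv (submatrix QX J UNIV))"
    define \<tau> where "\<tau> = frob_norm (A * (1\<^sub>m n - pinv X * X))"
    have a: "0 < a" using eps by (simp add: a_def)
    have "card (I \<union> I0) = k + card I0"
      using I I0 finite_subset[OF I(1)] finite_subset[OF I0(1)] by (subst card_Un_disjoint) auto
    then have N: "real N \<le> (1 + \<kappa>) * real k" using I0(3) by (simp add: N_def algebra_simps)
    \<comment> \<open>The polynomial \<open>p\<close> may take negative values, but then no output \<open>F\<close> is admissible.\<close>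
    have "0 \<le> g * a"
    proof -
      obtain C' where "computed_with_error (g * a) (submatrix A UNIV J) C'"
        using fl unfolding is_fl_cur_def g_def a_def by blast
      then obtain E where "spec_norm E \<le> g * a" unfolding computed_with_error_def by blast
      then show ?thesis using spec_norm_nonneg[of E] by linarith
    qed
    then have g: "0 \<le> g" using a by (simp add: zero_le_mult_iff)
    \<comment> \<open>Both summands are nonnegative, so each of them is below \<epsilon>. In the
      second, \<epsilon> < a allows \<open>a\<close> to be cancelled, which leaves a bound on
      \<open>u\<close> alone.\<close>
    have "gamma_factor q m n k u * a = 100 * (g * a) + ((1 + \<kappa>) * real k * u) * a"
      by (simp add: q_def g_def gamma_factor_def algebra_simps)
    moreover have nonneg: "0 \<le> (1 + \<kappa>) * real k * u" using assms u by simp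
    ultimately have ga: "100 * (g * a) \<le> \<epsilon>" and "((1 + \<kappa>) * real k * u) * a \<le> 1 * a"
      using small eps \<open>0 \<le> g * a\<close> mult_nonneg_nonneg[OF nonneg less_imp_le[OF a]] unfolding a_def by linarith+
    then have "(1 + \<kappa>) * real k * u \<le> 1" using a by (simp only: mult_le_cancel_right_pos)
    then have Nu: "real N * u \<le> 1" using mult_right_mono[OF N less_imp_le[OF u]] by linarith
    have I': "I \<subseteq> I \<union> I0" "I \<union> I0 \<subseteq> {..<m}" using I I0 by auto
    define c where "c = 4 * \<beta> * \<nu> * (\<tau> + 2 * \<epsilon>) + 3 * \<beta> * a * (g + 4 * real n * real N * u)"
    have F: "F \<in> carrier_mat m n" using fl A unfolding is_fl_cur_def by simp
    have nn: "0 \<le> \<beta>" "0 \<le> \<nu>" "0 \<le> \<tau>" by (simp_all add: \<beta>_def \<nu>_def \<tau>_def)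
    have c: "0 \<le> c" unfolding c_def using nn eps a g u by (intro add_nonneg_nonneg mult_nonneg_nonneg) auto
    \<comment> \<open>sqrt m \<le> m holds for every natural number, including 0, so the coefficient
      is dominated by a polynomial times \<open>u\<close>.\<close>
    have "sqrt (real m) * (3 * g + 12 * real N * real n * u)
        \<le> real m * (3 * g + 12 * ((1 + \<kappa>) * real k) * real n * u)"
    proof (rule mult_mono)
      show "sqrt (real m) \<le> real m"
        using le_square[of m] by (intro real_le_lsqrt) (simp_all add: power2_eq_square flip: of_nat_mult)
      show "3 * g + 12 * real N * real n * u \<le> 3 * g + 12 * ((1 + \<kappa>) * real k) * real n * u"
        using N u by (intro add_left_mono mult_right_mono) auto
    qed (use g u in auto)
    also have "\<dots> = gamma_factor r m n k u"
      by (simp add: r_def g_def gamma_factor_def algebra_simps)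
    finally have coeff: "sqrt (real m) * (3 * g + 12 * real N * real n * u) \<le> gamma_factor r m n k u" .
    have "frob_norm (A - F) \<le> sqrt (real m) * c"
    proof (rule frob_norm_le_rows[OF _ c])
      show "A - F \<in> carrier_mat m n" by (rule minus_carrier_mat[OF F])
      fix i assume i: "i < m"
      have "row (A - F) i = row A i - row F i" using A F i by auto
      then show "vec_norm2 (row (A - F) i) \<le> c"
        using fl_cur_row_error[OF A J k I'(1) I(2) I'(2) inv X rank QC QX less_imp_le[OF u]
            Nu[unfolded N_def] eps(1) less_imp_le[OF eps(2)] g ga[unfolded a_def] fl[folded g_def] i]
        by (simp add: c_def \<beta>_def \<nu>_def \<tau>_def N_def a_def)
    qed
    also have "sqrt (real m) * c = 4 * sqrt (real m) * \<beta> * \<nu> * (\<tau> + 2 * \<epsilon>)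
        + sqrt (real m) * (3 * g + 12 * real N * real n * u) * (a * \<beta>)"
      by (simp add: c_def algebra_simps)
    also have "\<dots> \<le> 4 * sqrt (real m) * \<beta> * \<nu> * (\<tau> + 2 * \<epsilon>) + gamma_factor r m n k u * (a * \<beta>)"
      using nn a by (intro add_left_mono mult_right_mono coeff) auto
    finally show "frob_norm (A - F)
        \<le> 4 * sqrt (real m) * spec_norm (pinv (submatrix QC (I \<union> I0) UNIV))
            * spec_norm (pinv (submatrix QX J UNIV))
            * (frob_norm (A * (1\<^sub>m n - pinv X * X)) + 2 * \<epsilon>)
          + gamma_factor r m n k u * spec_norm A
            * spec_norm (pinv (submatrix QC (I \<union> I0) UNIV))"
      by (simp add: \<beta>_def \<nu>_def \<tau>_def a_def mult.assoc)
  qed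
qed

end
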